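(* Let $m\ge 2$ and let $\omega:[0,1]\to[0,+\infty)$ be a piecewise $C^1$ function such that the function $\omega^{m-1}: t\mapsto \omega(t)^{m-1}$ is concave. Let $$\Omega=\left\{ y=(y_1,\bar y)\in\mathbb{R}\times\mathbb{R}^{m-1} \;\middle|\; 0\le y_1\le 1,\ |\bar y|\le \omega(y_1)\right\},$$ and assume that $\Omega$ is a body. Suppose that $k:(0,+\infty)\to\mathbb{R}$ is strictly decreasing and satisfies the condition $(C^1_\alpha)$ for some $\alpha>1$, and that $k'(r)/r$ is increasing on the interval $(d(\Omega),D(\Omega))$. Then $\Omega$ has a unique $k$-center.
   Context: A body in $\mathbb{R}^m$ is the closure of a (non-empty) bounded open set. Piecewise $C^1$ for $\omega$ is understood as: $\omega$ is continuous on $[0,1]$ and continuously differentiable off a finite set of points, so that for instance $\omega(t)=t^p$ with $0\le p\le 1/(m-1)$ is allowed. "Increasing" means non-decreasing. Condition $(C^1_\alpha)$ (for $\alpha>1$, in dimension $m$): $k$ is once continuously differentiable on $(0,+\infty)$ and, as $r\to0^+$, $k(r)=O(r^{\alpha-m})$ if $\alpha<m$, $k(r)=O(\log r)$ if $\alpha=m$, $k(r)=O(1)$ if $\alpha>m$; and $k'(r)=O(r^{\alpha-m-1})$ if $\alpha<m+1$, $k'(r)=O(\log r)$ if $\alpha=m+1$, $k'(r)=O(1)$ if $\alpha>m+1$. Potential: $K_\Omega(x)=\int_\Omega k(|x-y|)\,dy$ for $x\in\mathbb{R}^m$. A point $x\in\mathbb{R}^m$ is a $k$-center of $\Omega$ if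 it gives the maximum value of $K_\Omega$ on $\mathbb{R}^m$. Minimal unfolded region: for $v\in S^{m-1}$ and $b\in\mathbb{R}$, let $\mathrm{Refl}_{v,b}$ be the reflection of $\mathbb{R}^m$ in the hyperplane $\{z\mid z\cdot v=b\}$, and $\Omega^+_{v,b}=\{z\in\Omega\mid z\cdot v\ge b\}$. Put $l(v)=\min\{a\in\mathbb{R}\mid \forall b\ge a,\ \mathrm{Refl}_{v,b}(\Omega^+_{v,b})\subset\Omega\}$ and $Uf(\Omega)=\bigcap_{v\in S^{m-1}}\{z\in\mathbb{R}^m\mid z\cdot v\le l(v)\}$. It is a non-empty compact convex set. $d(\Omega)=\min\{|z-w| \mid z\in Uf(\Omega),\ w\in\partial\Omega\}$ and $D(\Omega)=\max\{|z-w| \mid z\in Uf(\Omega),\ w\in\partial\Omega\}$. *)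

theory Defs
  imports "HOL-Analysis.Analysis" "HOL-Library.Landau_Symbols"
begin

definition body :: "'a::euclidean_space set \<Rightarrow> bool" where
  "body S \<longleftrightarrow> (\<exists>U. open U \<and> bounded U \<and> U \<noteq> {} \<and> S = closure U)"

definition solid_of_revolution :: "(real \<Rightarrow> real) \<Rightarrow> (real \<times> 'a::euclidean_space) set" where
  "solid_of_revolution \<omega> = {y. 0 \<le> fst y \<and> fst y \<le> 1 \<and> norm (snd y) \<le> \<omega> (fst y)}"

text \<open>The condition $(C^1_\alpha)$ in dimension \<open>m\<close>.\<close>

definition C1_cond :: "nat \<Rightarrow> real \<Rightarrow> (real \<Rightarrow> real) \<Rightarrow> bool" where
  "C1_cond m \<alpha> k \<longleftrightarrow>
     k C1_differentiable_on {0<..} \<and>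
     (\<alpha> < real m \<longrightarrow> k \<in> O[at_right 0](\<lambda>r. r powr (\<alpha> - real m))) \<and>
     (\<alpha> = real m \<longrightarrow> k \<in> O[at_right 0](\<lambda>r. ln r)) \<and>
     (\<alpha> > real m \<longrightarrow> k \<in> O[at_right 0](\<lambda>r. 1)) \<and>
     (\<alpha> < real m + 1 \<longrightarrow> deriv k \<in> O[at_right 0](\<lambda>r. r powr (\<alpha> - real m - 1))) \<and>
     (\<alpha> = real m + 1 \<longrightarrow> deriv k \<in> O[at_right 0](\<lambda>r. ln r)) \<and>
     (\<alpha> > real m + 1 \<longrightarrow> deriv k \<in> O[at_right 0](\<lambda>r. 1))"

text \<open>Only \<open>k r\<close> for \<open>r > 0\<close> is meaningful; the value \<open>k 0\<close> enters at the single point \<open>y = x\<close>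
  only, which is a null set.\<close>

definition potential :: "(real \<Rightarrow> real) \<Rightarrow> 'a::euclidean_space set \<Rightarrow> 'a \<Rightarrow> real" where
  "potential k S x = (LINT y:S|lborel. k (norm (x - y)))"

definition k_center :: "(real \<Rightarrow> real) \<Rightarrow> 'a::euclidean_space set \<Rightarrow> 'a \<Rightarrow> bool" where
  "k_center k S x \<longleftrightarrow> (\<forall>z. potential k S z \<le> potential k S x)"

text \<open>The reflection in the hyperplane \<open>{z. z \<bullet> v = b}\<close>, for a unit vector \<open>v\<close>.\<close>

definition hyperplane_reflection :: "'a::euclidean_space \<Rightarrow> real \<Rightarrow> 'a \<Rightarrow> 'a" where
  "hyperplane_reflection v b z = z - (2 * (z \<bullet> v - b)) *\<^sub>R v"

text \<open>The minima and maxima below are written as \<open>Inf\<close> and \<open>Sup\<close>. For a body \<open>S\<close>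
  they are attained: the set of admissible \<open>a\<close> in \<open>fold_level\<close> is non-empty, bounded below and
  closed, and both the minimal unfolded region and the frontier of \<open>S\<close> are non-empty and
  compact.\<close>

definition fold_level :: "'a::euclidean_space set \<Rightarrow> 'a \<Rightarrow> real" where
  "fold_level S v =
     Inf {a. \<forall>b\<ge>a. hyperplane_reflection v b ` {z \<in> S. z \<bullet> v \<ge> b} \<subseteq> S}"

definition min_unfolded_region :: "'a::euclidean_space set \<Rightarrow> 'a set" where
  "min_unfolded_region S = (\<Inter>v\<in>sphere 0 1. {z. z \<bullet> v \<le> fold_level S v})"

definition dist_min :: "'a::euclidean_space set \<Rightarrow> real" where
  "dist_min S = Inf {norm (z - w) | z w. z \<in> min_unfolded_region S \<and> w \<in> frontier S}"

definition dist_max :: "'a::euclidean_space set \<Rightarrow> real" where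
  "dist_max S = Sup {norm (z - w) | z w. z \<in> min_unfolded_region S \<and> w \<in> frontier S}"

end

theory Submission
  imports Defs
begin

text \<open>A point outside the minimal unfolded region is moved to a point of larger potential by a
  reflection that folds \<open>\<Omega>\<close> into itself, so all centers lie in the minimal unfolded region,
  which for a solid of revolution is a segment on the axis; existence follows from upper
  semicontinuity of the potential. For uniqueness, the increment
  \<open>D s = K (s + \<delta>) - K (s - \<delta>)\<close> of the potential along the axis is shown to be strictly
  decreasing on this segment, which excludes two maxima. Reflecting in the hyperplane through \<open>s\<close>,
  \<open>D s\<close> is the integral over \<open>u > 0\<close> of \<open>J u (\<omega> (s + u)) - J u (\<omega> (s - u))\<close>, where \<open>J u \<rho>\<close>
  (\<open>slice_diff\<close> below) integrates a positive radial function over the \<open>(m - 1)\<close>-ball of radius \<open>\<rho>\<close>. Since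
  \<open>k' r / r\<close> is increasing, that function is radially decreasing, so \<open>J u \<rho>\<close> is an increasing
  concave function of \<open>\<rho>\<^sup>m\<^sup>-\<^sup>1\<close>; together with the concavity of \<open>\<omega>\<^sup>m\<^sup>-\<^sup>1\<close> this makes the integrand
  decreasing in \<open>s\<close>. Where one of the two points \<open>s \<plusminus> u\<close> leaves \<open>[0, 1]\<close>, the foldability
  encoded in the minimal unfolded region supplies the required monotonicity of \<open>\<omega>\<close>.\<close>

subsection \<open>Lebesgue measure and hyperplane reflections\<close>

text \<open>Source of every strict inequality between integrals below: a zero integral would force f
  to vanish almost everywhere and so make U null, but a nonempty open set is not negligible.\<close>

lemma integral_pos_of_open:
  fixes f :: "'a::euclidean_space \<Rightarrow> real"
  assumes "integrable lborel f" and "AE x in lborel. 0 \<le> f x"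
    and "open U" and "U \<noteq> {}" and "\<And>x. x \<in> U \<Longrightarrow> 0 < f x"
  shows "0 < integral\<^sup>L lborel f"
proof -
  have "\<not> (AE x in lborel. f x = 0)"
  proof
    assume "AE x in lborel. f x = 0"
    then have "AE x in lborel. x \<notin> U"
      by eventually_elim (use assms(5) in force)
    then have "U \<in> null_sets lborel"
      using \<open>open U\<close> by (subst AE_iff_null_sets) auto
    then have "negligible U"
      by (simp add: negligible_iff_null_sets null_sets_completionI)
    then show False
      using open_not_negligible assms(3,4) by blast
  qed
  then have "integral\<^sup>L lborel f \<noteq> 0"
    using integral_nonneg_eq_0_iff_AE[OF assms(1,2)] by simp
  moreover have "0 \<le> integral\<^sup>L lborel f"
    using assms(2) by (rule integral_nonneg_AE)
  ultimately show ?thesis by simp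
qed

text \<open>The image measure \<open>\<mu>\<close> is translation invariant and agrees with Lebesgue measure on a
  ball \<open>B\<close> around 0; evaluating the convolution of \<open>\<mu>\<close> on \<open>A\<close> and Lebesgue measure on \<open>B\<close>
  in two ways shows that \<open>\<mu> A\<close> is the Lebesgue measure of \<open>A\<close>.\<close>

lemma lborel_distr_orthogonal:
  fixes f :: "'a::euclidean_space \<Rightarrow> 'a"
  assumes f: "orthogonal_transformation f"
  shows "distr lborel borel f = (lborel :: 'a measure)"
proof -
  define \<mu> where "\<mu> = distr lborel borel f"
  have lin: "linear f" using f by (simp add: orthogonal_transformation_def)
  have cont: "continuous_on UNIV f"
    using lin by (simp add: linear_continuous_on linear_conv_bounded_linear)
  have [measurable]: "f \<in> borel_measurable borel"
    using cont by (rule borel_measurable_continuous_onI)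
  have [measurable_cong]: "sets \<mu> = sets borel" and [simp]: "space \<mu> = UNIV"
    by (simp_all add: \<mu>_def)
  let ?B = "ball 0 1 :: 'a set"
  have surj: "surj f" using f by (rule orthogonal_transformation_surj)
  have vim_ball: "f -` ball 0 r = ball 0 r" for r
    using orthogonal_transformation_norm[OF f] by (auto simp: dist_norm)
  have \<mu>_ball: "emeasure \<mu> (ball 0 r) = emeasure lborel (ball 0 r :: 'a set)" for r
    unfolding \<mu>_def by (subst emeasure_distr) (auto simp: vim_ball)
  have sf: "sigma_finite_measure \<mu>"
  proof
    show "\<exists>A. countable A \<and> A \<subseteq> sets \<mu> \<and> \<Union> A = space \<mu> \<and> (\<forall>a\<in>A. emeasure \<mu> a \<noteq> \<infinity>)"
    proof (intro exI conjI ballI)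
      show "countable (range (\<lambda>n::nat. ball 0 (real n) :: 'a set))" by simp
      show "range (\<lambda>n::nat. ball 0 (real n)) \<subseteq> sets \<mu>" by (auto simp: \<mu>_def)
      show "\<Union> (range (\<lambda>n::nat. ball 0 (real n))) = space \<mu>"
        by (auto simp: reals_Archimedean2)
      fix a assume "a \<in> range (\<lambda>n::nat. ball 0 (real n) :: 'a set)"
      then show "emeasure \<mu> a \<noteq> \<infinity>"
        using emeasure_bounded_finite[of a] by (auto simp: \<mu>_ball)
    qed
  qed
  interpret P: pair_sigma_finite \<mu> "lborel :: 'a measure"
    using sf by (intro pair_sigma_finite.intro) (auto intro: sigma_finite_lborel)
  have shift: "(\<integral>\<^sup>+x. g x \<partial>\<mu>) = (\<integral>\<^sup>+x. g (y + x) \<partial>\<mu>)"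
    if [measurable]: "g \<in> borel_measurable borel" for g :: "'a \<Rightarrow> ennreal" and y
  proof -
    \<comment> \<open>By linearity f (z + x) = y + f x, so translating the source by z translates
      the image by y.\<close>
    obtain z where z: "f z = y" using surj by (metis surjD)
    have "(\<integral>\<^sup>+x. g x \<partial>\<mu>) = (\<integral>\<^sup>+x. g (f x) \<partial>lborel)"
      unfolding \<mu>_def by (subst nn_integral_distr) auto
    also have "\<dots> = (\<integral>\<^sup>+x. g (f x) \<partial>distr lborel borel ((+) z))"
      by (simp add: lborel_distr_plus)
    also have "\<dots> = (\<integral>\<^sup>+x. g (y + f x) \<partial>lborel)"
      by (subst nn_integral_distr) (auto simp: linear_add[OF lin] z)
    also have "\<dots> = (\<integral>\<^sup>+x. g (y + x) \<partial>\<mu>)"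
      unfolding \<mu>_def by (subst nn_integral_distr) auto
    finally show ?thesis .
  qed
  have shiftl: "(\<integral>\<^sup>+x. g x \<partial>lborel) = (\<integral>\<^sup>+x. g (y + x) \<partial>lborel)"
    if [measurable]: "g \<in> borel_measurable borel" for g :: "'a \<Rightarrow> ennreal" and y
    by (subst lborel_distr_plus[of y, symmetric], subst nn_integral_distr) auto
  let ?c = "emeasure lborel ?B"
  have [measurable]: "(\<lambda>x. indicator ?B (g x) :: ennreal) \<in> borel_measurable M"
    if "g \<in> borel_measurable M" for g :: "'b \<Rightarrow> 'a" and M
    by (rule measurable_compose[OF that]) (intro borel_measurable_indicator borel_open open_ball)
  have c0: "?c \<noteq> 0" "?c \<noteq> \<infinity>"
    using emeasure_bounded_finite[of ?B] unit_ball_vol_pos[of "real DIM('a)"]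
    by (auto simp: emeasure_ball simp del: unit_ball_vol_pos)
  have eq: "emeasure \<mu> A = emeasure lborel A" if [measurable]: "A \<in> sets borel" for A
  proof -
    have c1: "?c = (\<integral>\<^sup>+y. indicator ?B (x - y) \<partial>lborel)" for x
    proof -
      have "?c = (\<integral>\<^sup>+y. indicator ?B y \<partial>lborel)" by simp
      also have "\<dots> = (\<integral>\<^sup>+y. indicator ?B (- x + y) \<partial>lborel)"
        by (rule shiftl) (intro borel_measurable_indicator borel_open open_ball)
      also have "\<dots> = (\<integral>\<^sup>+y. indicator ?B (x - y) \<partial>lborel)"
        by (intro nn_integral_cong) (auto simp: indicator_def dist_norm norm_minus_commute)
      finally show ?thesis .
    qed
    have A1: "emeasure lborel A = (\<integral>\<^sup>+y. indicator A (y + x) \<partial>lborel)" for x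
      using shiftl[of "indicator A" x] by (simp add: add.commute)
    have "emeasure \<mu> A * ?c = (\<integral>\<^sup>+x. indicator A x * ?c \<partial>\<mu>)"
      by (subst nn_integral_multc) (auto simp: \<mu>_def)
    also have "\<dots> = (\<integral>\<^sup>+x. (\<integral>\<^sup>+y. indicator A x * indicator ?B (x - y) \<partial>lborel) \<partial>\<mu>)"
      by (simp add: nn_integral_cmult c1[symmetric])
    also have "\<dots> = (\<integral>\<^sup>+y. (\<integral>\<^sup>+x. indicator A x * indicator ?B (x - y) \<partial>\<mu>) \<partial>lborel)"
      by (rule P.Fubini'[symmetric]) measurable
    \<comment> \<open>For fixed y, invariance of \<open>\<mu>\<close> under translation by y moves
      the shift from the ball to A.\<close>
    also have "\<dots> = (\<integral>\<^sup>+y. (\<integral>\<^sup>+x. indicator A (y + x) * indicator ?B x \<partial>\<mu>) \<partial>lborel)"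
    proof (rule nn_integral_cong)
      fix y
      have "(\<lambda>x. indicator A x * indicator ?B (x - y) :: ennreal) \<in> borel_measurable borel"
        by measurable
      from shift[OF this, of y] show "(\<integral>\<^sup>+x. indicator A x * indicator ?B (x - y) \<partial>\<mu>)
          = (\<integral>\<^sup>+x. indicator A (y + x) * indicator ?B x \<partial>\<mu>)"
        by simp
    qed
    also have "\<dots> = (\<integral>\<^sup>+x. (\<integral>\<^sup>+y. indicator A (y + x) * indicator ?B x \<partial>lborel) \<partial>\<mu>)"
      by (rule P.Fubini') measurable
    also have "\<dots> = (\<integral>\<^sup>+x. emeasure lborel A * indicator ?B x \<partial>\<mu>)"
      by (subst nn_integral_multc) (auto simp: A1[symmetric])
    also have "\<dots> = emeasure lborel A * ?c"
      using \<mu>_ball[of 1] by (subst nn_integral_cmult) (auto simp: \<mu>_def)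
    finally show ?thesis
      using c0 ennreal_mult_cancel_left[of ?c] by (auto simp: mult.commute)
  qed
  have "\<mu> = lborel"
    by (rule measure_eqI) (auto simp: \<mu>_def[symmetric] eq \<open>sets \<mu> = sets borel\<close>)
  then show ?thesis by (simp add: \<mu>_def)
qed

section \<open>Hyperplane reflections as measure-preserving isometries\<close>

lemma hyperplane_reflection_involution:
  assumes "norm v = 1"
  shows "hyperplane_reflection v b (hyperplane_reflection v b z) = z"
  using assms by (simp add: hyperplane_reflection_def norm_eq_1 algebra_simps flip: scaleR_add_left)

lemma hyperplane_reflection_inner:
  assumes "norm v = 1"
  shows "hyperplane_reflection v b z \<bullet> v = 2 * b - z \<bullet> v"
  using assms by (simp add: hyperplane_reflection_def norm_eq_1 algebra_simps)

text \<open>The sign of the product decides whether x or its mirror image is closer to y: if x and y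
  lie strictly on opposite sides of the hyperplane, the mirror image is.\<close>

lemma norm_diff_hyperplane_reflection_sq:
  assumes "norm v = 1"
  shows "(norm (hyperplane_reflection v b x - y))\<^sup>2
    = (norm (x - y))\<^sup>2 + 4 * (x \<bullet> v - b) * (y \<bullet> v - b)"
  using assms
  by (simp add: hyperplane_reflection_def norm_eq_1 power2_norm_eq_inner algebra_simps inner_commute)

lemma norm_hyperplane_reflection_diff:
  assumes "norm v = 1"
  shows "norm (hyperplane_reflection v b x - hyperplane_reflection v b y) = norm (x - y)"
proof -
  have "(norm (hyperplane_reflection v b x - hyperplane_reflection v b y))\<^sup>2 = (norm (x - y))\<^sup>2"
    using assms
    by (simp add: norm_diff_hyperplane_reflection_sq hyperplane_reflection_inner
        norm_minus_commute[of x])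
      (simp add: algebra_simps)
  then show ?thesis by simp
qed

text \<open>The map is the orthogonal reflection in the parallel hyperplane through 0, followed by
  the translation by 2 b v.\<close>

lemma lborel_distr_hyperplane_reflection:
  fixes v :: "'a::euclidean_space"
  assumes "norm v = 1"
  shows "distr lborel borel (hyperplane_reflection v b) = (lborel :: 'a measure)"
proof -
  let ?l = "\<lambda>z::'a. z - (2 * (z \<bullet> v)) *\<^sub>R v"
  have "orthogonal_transformation ?l"
    unfolding orthogonal_transformation_def
  proof
    show "linear ?l"
      by (rule linearI) (auto simp: algebra_simps)
    show "\<forall>x y. ?l x \<bullet> ?l y = x \<bullet> y"
      using assms by (simp add: norm_eq_1 algebra_simps inner_commute)
  qed
  then have "distr lborel borel ?l = lborel" by (rule lborel_distr_orthogonal)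
  then have "lborel = distr (distr lborel borel ?l) borel ((+) ((2 * b) *\<^sub>R v))"
    by (simp add: lborel_distr_plus)
  also have "\<dots> = distr lborel borel ((+) ((2 * b) *\<^sub>R v) \<circ> ?l)"
    by (rule distr_distr) auto
  also have "(+) ((2 * b) *\<^sub>R v) \<circ> ?l = hyperplane_reflection v b"
    by (auto simp: fun_eq_iff hyperplane_reflection_def algebra_simps)
  finally show ?thesis by simp
qed

lemma borel_measurable_hyperplane_reflection [measurable]:
  "hyperplane_reflection v b \<in> borel_measurable borel"
  unfolding hyperplane_reflection_def by measurable

lemma has_bochner_integral_hyperplane_reflection:
  fixes f :: "'a::euclidean_space \<Rightarrow> real"
  assumes "norm v = 1" and f: "integrable lborel f"
  shows "has_bochner_integral lborel (\<lambda>y. f (hyperplane_reflection v b y)) (integral\<^sup>L lborel f)"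
proof -
  note eq = lborel_distr_hyperplane_reflection[OF assms(1), of b]
  have [measurable]: "f \<in> borel_measurable borel" using f by auto
  have "integrable lborel (\<lambda>y. f (hyperplane_reflection v b y))"
    by (rule integrable_distr[where M'=borel]) (use f in \<open>auto simp: eq\<close>)
  moreover have "integral\<^sup>L lborel f = (\<integral>y. f (hyperplane_reflection v b y) \<partial>lborel)"
    by (subst eq[symmetric], subst integral_distr) auto
  ultimately show ?thesis by (simp add: has_bochner_integral_iff)
qed

subsection \<open>Local integrability of the kernel\<close>

text \<open>Dyadic decomposition: where the norm lies between 1/2^(j+1) and 1/2^j the integrand is
  at most 2^((j+1) p), while the ball of radius 1/2^j has volume proportional to 1/2^(j n) with n >=
  p + 1. A geometric series dominates the integral.\<close>

lemma integrable_inverse_norm_power_ball: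
  assumes p: "p < DIM('a::euclidean_space)"
  shows "integrable lborel (\<lambda>z::'a. indicator (ball 0 1) z / norm z ^ p)"
proof -
  let ?f = "\<lambda>z::'a. indicator (ball 0 1) z / norm z ^ p :: real"
  let ?B = "\<lambda>j::nat. ball 0 ((1/2)^j) :: 'a set"
  define V where "V = unit_ball_vol (DIM('a))"
  have V: "V \<ge> 0" by (simp add: V_def)
  have elem: "F i \<le> (\<Sum>j. F j)" for F :: "nat \<Rightarrow> ennreal" and i
    using sum_le_suminf[of F "{i}"] by simp
  have bound: "ennreal (?f z) \<le> (\<Sum>j. ennreal (2 ^ (Suc j * p)) * indicator (?B j) z)" for z
  proof (cases "z \<in> ball 0 1 \<and> z \<noteq> 0")
    case True
    \<comment> \<open>The least such index selects the dyadic shell of z: minimality bounds the norm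
      strictly from above by \<open>(1/2) ^ j\<close>.\<close>
    define j where "j = (LEAST n. (1/2) ^ Suc n \<le> norm z)"
    have "\<exists>n. (1/2::real) ^ n < norm z"
      using True by (intro real_arch_pow_inv) auto
    then obtain n where "(1/2::real) ^ n < norm z" by blast
    then have "(1/2::real) ^ Suc n \<le> norm z"
      by (simp add: field_simps)
    then have j1: "(1/2) ^ Suc j \<le> norm z"
      unfolding j_def by (rule LeastI)
    have j2: "norm z < (1/2) ^ j"
    proof (cases j)
      case 0
      then show ?thesis using True by simp
    next
      case (Suc i)
      then have "\<not> (1/2) ^ Suc i \<le> norm z"
        unfolding j_def by (intro not_less_Least) simp
      then show ?thesis using Suc by simp
    qed
    have "((1/2) ^ Suc j) ^ p \<le> norm z ^ p"
      using j1 by (rule power_mono) simp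
    then have "1 / norm z ^ p \<le> 1 / ((1/2) ^ Suc j) ^ p"
      using True by (intro divide_left_mono) (auto intro!: mult_pos_pos)
    also have "\<dots> = 2 ^ (Suc j * p)"
      by (simp only: power_mult power_one_over) simp
    finally have "ennreal (?f z) \<le> ennreal (2 ^ (Suc j * p)) * indicator (?B j) z"
      using True j2 by (simp add: ennreal_leI)
    also have "\<dots> \<le> (\<Sum>j. ennreal (2 ^ (Suc j * p)) * indicator (?B j) z)"
      by (rule elem)
    finally show ?thesis .
  next
    case False
    \<comment> \<open>At z = 0 the quotient is 0 by the convention on division, except for p = 0,
      where it is 1; outside the unit ball the indicator vanishes.\<close>
    have "ennreal (?f z) \<le> ennreal (2 ^ (Suc 0 * p)) * indicator (?B 0) z"
      using False by (cases "p = 0") (auto simp: power_0_left)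
    also have "\<dots> \<le> (\<Sum>j. ennreal (2 ^ (Suc j * p)) * indicator (?B j) z)"
      by (rule elem)
    finally show ?thesis .
  qed
  have shell: "ennreal (2 ^ (Suc j * p)) * emeasure lborel (?B j) \<le> ennreal (2 ^ p * V * (1/2) ^ j)"
    for j
  proof -
    have "2 ^ (j * p) * (1/2) ^ (j * DIM('a)) \<le> 2 ^ (j * p) * (1/2::real) ^ (j * Suc p)"
      using p by (intro mult_left_mono power_decreasing mult_le_mono2) auto
    also have "\<dots> = (1/2) ^ j"
      by (simp add: power_add power_one_over field_simps)
    finally have le: "2 ^ (j * p) * (1/2) ^ (j * DIM('a)) \<le> (1/2::real) ^ j" .
    have "ennreal (2 ^ (Suc j * p)) * emeasure lborel (?B j)
        = ennreal (2 ^ (Suc j * p)) * ennreal (V * (1/2) ^ (j * DIM('a)))"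
      by (subst emeasure_ball) (auto simp: V_def power_mult)
    also have "\<dots> = ennreal (2 ^ p * V * (2 ^ (j * p) * (1/2) ^ (j * DIM('a))))"
      using V by (subst ennreal_mult'[symmetric]) (auto simp: power_add algebra_simps)
    also have "\<dots> \<le> ennreal (2 ^ p * V * (1/2) ^ j)"
      using le V by (intro ennreal_leI mult_left_mono) auto
    finally show ?thesis .
  qed
  have "(\<integral>\<^sup>+z. ennreal (?f z) \<partial>lborel)
      \<le> (\<integral>\<^sup>+z. (\<Sum>j. ennreal (2 ^ (Suc j * p)) * indicator (?B j) z) \<partial>lborel)"
    by (intro nn_integral_mono bound)
  also have "\<dots> = (\<Sum>j. \<integral>\<^sup>+z. ennreal (2 ^ (Suc j * p)) * indicator (?B j) z \<partial>lborel)"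
    by (rule nn_integral_suminf) (intro borel_measurable_times_ennreal borel_measurable_indicator, auto)
  also have "\<dots> = (\<Sum>j. ennreal (2 ^ (Suc j * p)) * emeasure lborel (?B j))"
    by (intro suminf_cong nn_integral_cmult_indicator) auto
  also have "\<dots> \<le> (\<Sum>j. ennreal (2 ^ p * V * (1/2) ^ j))"
    by (intro suminf_le shell) auto
  also have "\<dots> = ennreal (\<Sum>j. 2 ^ p * V * (1/2) ^ j)"
    using V by (intro suminf_ennreal2 summable_mult summable_geometric) auto
  also have "\<dots> < \<infinity>" by simp
  finally show ?thesis
    by (intro integrableI_nonneg borel_measurable_divide borel_measurable_indicator) auto
qed

text \<open>Since \<open>k 0\<close> is arbitrary, continuity is available only off the origin,
  which is split off as a measurable piece.\<close>

lemma borel_measurable_radial: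
  assumes "continuous_on {0<..} k"
  shows "(\<lambda>z::'a::euclidean_space. k (norm z) :: real) \<in> borel_measurable borel"
proof -
  have "continuous_on (- {0::'a}) (\<lambda>z. k (norm z))"
    by (rule continuous_on_compose2[OF assms]) (auto intro!: continuous_intros)
  then have "(\<lambda>z::'a. if z \<in> {0} then k 0 else k (norm z)) \<in> borel_measurable borel"
    by (intro borel_measurable_continuous_on_if) auto
  also have "(\<lambda>z::'a. if z \<in> {0} then k 0 else k (norm z)) = (\<lambda>z. k (norm z))"
    by auto
  finally show ?thesis .
qed

lemma C1_cond_imp_continuous_on:
  "C1_cond m \<alpha> k \<Longrightarrow> continuous_on {0<..} k"
  by (simp add: C1_cond_def C1_differentiable_imp_continuous_on)

text \<open>The three growth regimes are merged into one bound of exponent m - 1, below the critical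
  exponent m. For r < 1, \<alpha> > 1 gives the power case, and m >= 2 lets 1 / r absorb the
  logarithm and the constant.\<close>

lemma C1_cond_imp_bound_at_0:
  assumes "C1_cond m \<alpha> k" and "2 \<le> m" and "1 < \<alpha>"
  shows "\<exists>C>0. \<exists>e>0. \<forall>r. 0 < r \<longrightarrow> r < e \<longrightarrow> \<bar>k r\<bar> \<le> C / r ^ (m - 1)"
proof -
  define g where "g = (\<lambda>r::real. if \<alpha> < m then r powr (\<alpha> - real m) else if \<alpha> = m then ln r else 1)"
  have "k \<in> O[at_right 0](g)"
  proof (cases \<alpha> "real m" rule: linorder_cases)
    case less
    then have "g = (\<lambda>r. r powr (\<alpha> - real m))" by (auto simp: g_def)
    with assms(1) less show ?thesis by (simp add: C1_cond_def)
  next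
    case equal
    then have "g = ln" by (auto simp: g_def)
    with assms(1) equal show ?thesis by (simp add: C1_cond_def)
  next
    case greater
    then have "g = (\<lambda>r. 1)" by (auto simp: g_def)
    with assms(1) greater show ?thesis by (simp add: C1_cond_def)
  qed
  then obtain c where c: "c > 0" "eventually (\<lambda>r. norm (k r) \<le> c * norm (g r)) (at_right 0)"
    by (rule landau_o.bigE)
  then obtain b where b: "b > 0" "\<And>r. 0 < r \<Longrightarrow> r < b \<Longrightarrow> \<bar>k r\<bar> \<le> c * \<bar>g r\<bar>"
    by (auto simp: eventually_at_right_field)
  have g: "\<bar>g r\<bar> \<le> 1 / r ^ (m - 1)" if r: "0 < r" "r < 1" for r
  proof -
    have eq: "1 / r ^ (m - 1) = r powr (1 - real m)"
      using r assms(2) by (simp add: powr_diff powr_realpow field_simps power_eq_if)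
    have inv: "1 / r \<le> 1 / r ^ (m - 1)"
    proof (intro divide_left_mono)
      have "r ^ (m - 1) \<le> r ^ 1"
        using r assms(2) by (intro power_decreasing) auto
      then show "r ^ (m - 1) \<le> r" by simp
    qed (use r in auto)
    show ?thesis
    proof (cases \<alpha> "real m" rule: linorder_cases)
      case less
      then show ?thesis
        using r assms(3) unfolding eq by (simp add: g_def powr_mono')
    next
      case equal
      have "\<bar>ln r\<bar> = ln (1 / r)" using r by (simp add: ln_div)
      also have "\<dots> \<le> 1 / r - 1" using r by (intro ln_le_minus_one) auto
      finally show ?thesis using equal inv by (simp add: g_def)
    next
      case greater
      have "1 \<le> 1 / r" using r by simp
      with greater inv show ?thesis by (simp add: g_def)
    qed
  qed
  show ?thesis
  proof (rule exI[of _ c], intro conjI exI[of _ "min b 1"] allI impI)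
    fix r :: real assume r: "0 < r" "r < min b 1"
    then have "\<bar>k r\<bar> \<le> c * \<bar>g r\<bar>" using b(2) by simp
    also have "\<dots> \<le> c * (1 / r ^ (m - 1))"
      using r g c(1) by (intro mult_left_mono) auto
    finally show "\<bar>k r\<bar> \<le> c / r ^ (m - 1)" by simp
  qed (use b c in auto)
qed

lemma locally_integrable_radial:
  assumes "C1_cond (DIM('a)) \<alpha> k" and "2 \<le> DIM('a)" and "1 < \<alpha>"
  shows "integrable lborel (\<lambda>z::'a::euclidean_space. indicator (cball 0 R) z * k (norm z))"
proof -
  let ?m = "DIM('a)"
  obtain e C where C: "0 < e" "0 < C" "\<And>r. 0 < r \<Longrightarrow> r < e \<Longrightarrow> \<bar>k r\<bar> \<le> C / r ^ (?m - 1)"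
    using C1_cond_imp_bound_at_0[OF assms] by metis
  have cont: "continuous_on {0<..} k" using assms(1) by (rule C1_cond_imp_continuous_on)
  have "continuous_on {e..R} k"
    using cont by (rule continuous_on_subset) (use C(1) in auto)
  then have "compact (k ` {e..R})" by (intro compact_continuous_image) auto
  then obtain M where M: "0 < M" "\<And>r. r \<in> {e..R} \<Longrightarrow> \<bar>k r\<bar> \<le> M"
    using compact_imp_bounded[THEN bounded_pos[THEN iffD1]] by (metis image_eqI real_norm_def)
  note meas = borel_measurable_radial[OF cont, where 'a='a]
  \<comment> \<open>The constant C + M covers what the singular term misses: M bounds k for radii
    from e to R, and C bounds it for radii from 1 up to e in case e > 1.\<close>
  have int: "integrable lborel (\<lambda>z::'a. C * (indicator (ball 0 1) z / norm z ^ (?m - 1))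
      + (C + M) * indicator (cball 0 R) z)"
    using assms(2) emeasure_bounded_finite[of "cball 0 R :: 'a set"]
    by (intro Bochner_Integration.integrable_add integrable_mult_right
        integrable_inverse_norm_power_ball) auto
  show ?thesis
  proof (rule Bochner_Integration.integrable_bound[OF int])
    show "(\<lambda>z::'a. indicator (cball 0 R) z * k (norm z)) \<in> borel_measurable lborel"
      using meas by (intro borel_measurable_times borel_measurable_indicator) auto
    have "AE z in lborel. z \<noteq> (0::'a)" by (rule AE_lborel_singleton)
    then show "AE z in lborel. norm (indicator (cball 0 R) z * k (norm z))
        \<le> norm (C * (indicator (ball (0::'a) 1) z / norm z ^ (?m - 1)) + (C + M) * indicator (cball 0 R) z)"
    proof eventually_elim
      case (elim z)
      let ?b = "C * (indicator (ball (0::'a) 1) z / norm z ^ (?m - 1)) + (C + M) * indicator (cball 0 R) z"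
      have nn: "0 \<le> C * (indicator (ball (0::'a) 1) z / norm z ^ (?m - 1))"
        using C(2) by simp
      have "\<bar>indicator (cball 0 R) z * k (norm z)\<bar> \<le> ?b"
      proof (cases "norm z \<le> R")
        case True
        show ?thesis
        proof (cases "norm z < e")
          case less: True
          have "\<bar>k (norm z)\<bar> \<le> C / norm z ^ (?m - 1)"
            using C(3) less elim by simp
          also have "\<dots> \<le> ?b"
          proof (cases "norm z < 1")
            case True
            then show ?thesis using C M by (auto simp: field_simps)
          next
            case False
            then have "C / norm z ^ (?m - 1) \<le> C / 1"
              using C(2) by (intro divide_left_mono) (auto intro!: one_le_power zero_less_power)
            also have "\<dots> \<le> ?b" using nn M \<open>norm z \<le> R\<close> by simp
            finally show ?thesis .
          qed
          finally show ?thesis using True by simp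
        next
          case False
          then have "\<bar>k (norm z)\<bar> \<le> M" using M(2) True by simp
          moreover have "indicator (cball (0::'a) R) z = (1::real)" using True by simp
          ultimately show ?thesis using nn C(2) by (simp only: mult_1 mult_1_right)
        qed
      next
        case False
        then show ?thesis using nn by simp
      qed
      then show ?case by (metis abs_ge_self order_trans real_norm_def)
    qed
  qed
qed

subsection \<open>Reflections and the minimal unfolded region\<close>

definition foldable :: "'a::euclidean_space set \<Rightarrow> 'a \<Rightarrow> real \<Rightarrow> bool" where
  "foldable S v b \<longleftrightarrow> (\<forall>z\<in>S. b \<le> z \<bullet> v \<longrightarrow> hyperplane_reflection v b z \<in> S)"

lemma fold_level_altdef: "fold_level S v = Inf {a. \<forall>b\<ge>a. foldable S v b}"
  unfolding fold_level_def foldable_def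
  by (rule arg_cong[where f=Inf]) auto

lemma body_imp_compact: "body S \<Longrightarrow> compact S"
  unfolding body_def by (auto simp: compact_closure)

lemma body_nonempty: "body S \<Longrightarrow> S \<noteq> {}"
  unfolding body_def by auto

text \<open>The closure of an open set has no lower-dimensional pieces: each of its points is a
  limit of points of the open set. This supplies the open sets on which strict inequalities are
  tested.\<close>

lemma body_open_in_interior:
  assumes "body S" and "open W" and "x \<in> S" and "x \<in> W"
  shows "\<exists>U. open U \<and> U \<noteq> {} \<and> U \<subseteq> S \<inter> W"
proof -
  obtain U where U: "open U" "S = closure U" using assms(1) by (auto simp: body_def)
  then have "U \<inter> W \<noteq> {}"
    using assms(2-4) by (metis Int_commute IntI empty_iff open_Int_closure_eq_empty)
  moreover have "U \<inter> W \<subseteq> S \<inter> W" using U closure_subset by blast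
  ultimately show ?thesis using U assms(2) by blast
qed

text \<open>Translating by -x reduces the claim to local integrability at the origin, since S lies
  in a ball about x of radius B + |x|.\<close>

lemma integrable_potential:
  fixes S :: "'a::euclidean_space set" and k :: "real \<Rightarrow> real"
  assumes cont: "continuous_on {0<..} k"
    and loc: "\<And>R. integrable lborel (\<lambda>z::'a. indicator (cball 0 R) z * k (norm z))"
    and S: "compact S"
  shows "integrable lborel (\<lambda>y. indicator S y * k (norm (x - y)))"
proof -
  obtain B where B: "\<And>y. y \<in> S \<Longrightarrow> norm y \<le> B"
    using compact_imp_bounded[OF S] by (auto simp: bounded_iff)
  let ?R = "B + norm x"
  have "integrable (distr lborel borel ((+) (- x))) (\<lambda>z::'a. indicator (cball 0 ?R) z * k (norm z))"
    using loc by (simp add: lborel_distr_plus)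
  from integrable_distr[OF _ this]
  have *: "integrable lborel (\<lambda>y. indicator (cball 0 ?R) (- x + y) * k (norm (- x + y)))"
    by simp
  have m: "(\<lambda>y. k (norm (x - y))) \<in> borel_measurable borel"
    by (rule measurable_compose[OF _ borel_measurable_radial[OF cont]]) measurable
  show ?thesis
  proof (rule Bochner_Integration.integrable_bound[OF *])
    show "(\<lambda>y. indicator S y * k (norm (x - y))) \<in> borel_measurable lborel"
      using m S by (intro borel_measurable_times borel_measurable_indicator)
        (auto intro: borel_closed compact_imp_closed)
    show "AE y in lborel. norm (indicator S y * k (norm (x - y)))
        \<le> norm (indicator (cball 0 ?R) (- x + y) * k (norm (- x + y)))"
    proof (rule AE_I2)
      fix y :: 'a
      have "norm (- x + y) \<le> ?R" if "y \<in> S"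
        using B[OF that] norm_triangle_ineq4[of y x] by simp
      moreover have "norm (- x + y) = norm (x - y)"
        by (metis minus_diff_eq norm_minus_cancel uminus_add_conv_diff)
      ultimately show "norm (indicator S y * k (norm (x - y)))
          \<le> norm (indicator (cball 0 ?R) (- x + y) * k (norm (- x + y)))"
        by (auto simp: indicator_def)
    qed
  qed
qed

lemma potential_altdef: "potential k S x = (\<integral>y. indicator S y * k (norm (x - y)) \<partial>lborel)"
  by (simp add: potential_def set_lebesgue_integral_def)

text \<open>With \<open>F y = k |x' - y| - k |x - y|\<close>, which is odd under the reflection \<open>\<sigma>\<close>, twice
  the difference of the potentials is the integral of \<open>(1\<^sub>S - 1\<^sub>S \<circ> \<sigma>) F \<ge> 0\<close>.\<close>

lemma potential_less_hyperplane_reflection: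
  fixes S :: "'a::euclidean_space set"
  assumes cont: "continuous_on {0<..} k"
    and loc: "\<And>R. integrable lborel (\<lambda>z::'a. indicator (cball 0 R) z * k (norm z))"
    and k: "strict_antimono_on {0<..} k"
    and S: "compact S" and v: "norm v = 1" and fold: "foldable S v b" and x: "b < x \<bullet> v"
    and U: "open U" "U \<noteq> {}" "\<And>y. y \<in> U \<Longrightarrow> y \<in> S \<and> y \<bullet> v < b \<and> hyperplane_reflection v b y \<notin> S"
  shows "potential k S x < potential k S (hyperplane_reflection v b x)"
proof -
  define \<sigma> where "\<sigma> = hyperplane_reflection v b"
  define F where "F y = k (norm (\<sigma> x - y)) - k (norm (x - y))" for y
  define G where "G y = (indicator S y - indicator S (\<sigma> y)) * F y" for y
  have invol [simp]: "\<sigma> (\<sigma> y) = y" for y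
    using hyperplane_reflection_involution[OF v] by (simp add: \<sigma>_def)
  have \<sigma>_inner: "\<sigma> y \<bullet> v = 2 * b - y \<bullet> v" for y
    using hyperplane_reflection_inner[OF v] by (simp add: \<sigma>_def)
  have isom: "norm (\<sigma> y - \<sigma> z) = norm (y - z)" for y z
    using norm_hyperplane_reflection_diff[OF v] by (simp add: \<sigma>_def)
  have odd: "F (\<sigma> y) = - F y" for y
    using isom[of x y] isom[of "\<sigma> x" y] by (simp add: F_def)
  \<comment> \<open>Below the hyperplane the mirror image of x is the closer source. The point y =
    \<sigma> x is excluded because k is controlled at positive distances only.\<close>
  have F_pos: "0 < F y" if "y \<bullet> v < b" "y \<noteq> \<sigma> x" for y
  proof -
    have "(norm (\<sigma> x - y))\<^sup>2 < (norm (x - y))\<^sup>2"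
      using norm_diff_hyperplane_reflection_sq[OF v, of b x y] x that
      by (simp add: \<sigma>_def mult_pos_neg)
    then have "norm (\<sigma> x - y) < norm (x - y)"
      by (rule power2_less_imp_less) simp
    moreover have "0 < norm (\<sigma> x - y)" using that by simp
    moreover from calculation have "0 < norm (x - y)" by linarith
    ultimately have "k (norm (x - y)) < k (norm (\<sigma> x - y))"
      using monotone_onD[OF k, of "norm (\<sigma> x - y)" "norm (x - y)"] by (simp only: greaterThan_iff)
    then show ?thesis by (simp add: F_def)
  qed
  have int: "integrable lborel (\<lambda>y. indicator S y * F y)"
    unfolding F_def right_diff_distrib
    by (intro Bochner_Integration.integrable_diff integrable_potential[OF cont loc S])
  have eq: "potential k S (\<sigma> x) - potential k S x = (\<integral>y. indicator S y * F y \<partial>lborel)"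
    unfolding F_def right_diff_distrib potential_altdef
    by (intro Bochner_Integration.integral_diff[symmetric] integrable_potential[OF cont loc S])
  have "has_bochner_integral lborel (\<lambda>y. indicator S (\<sigma> y) * F (\<sigma> y)) (\<integral>y. indicator S y * F y \<partial>lborel)"
    using has_bochner_integral_hyperplane_reflection[OF v int] by (simp add: \<sigma>_def)
  then have refl: "integrable lborel (\<lambda>y. indicator S (\<sigma> y) * F (\<sigma> y))"
      "(\<integral>y. indicator S (\<sigma> y) * F (\<sigma> y) \<partial>lborel) = (\<integral>y. indicator S y * F y \<partial>lborel)"
    by (simp_all add: has_bochner_integral_iff)
  have G_eq: "G = (\<lambda>y. indicator S y * F y + indicator S (\<sigma> y) * F (\<sigma> y))"
    by (auto simp: fun_eq_iff G_def odd algebra_simps)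
  have intG: "integrable lborel G"
    unfolding G_eq using int refl(1) by (rule Bochner_Integration.integrable_add)
  have "integral\<^sup>L lborel G = 2 * (potential k S (\<sigma> x) - potential k S x)"
    unfolding G_eq eq by (subst Bochner_Integration.integral_add[OF int refl(1)]) (simp add: refl(2))
  moreover have "0 < integral\<^sup>L lborel G"
  proof (rule integral_pos_of_open[OF intG])
    have low: "0 \<le> G y" if "y \<bullet> v < b" "y \<noteq> \<sigma> x" for y
    proof -
      \<comment> \<open>Here \<sigma> y lies above the hyperplane, so folding carries it back to y
        inside S.\<close>
      have "\<sigma> y \<in> S \<Longrightarrow> y \<in> S"
        using fold that \<sigma>_inner[of y] unfolding foldable_def \<sigma>_def[symmetric]
        by (metis add_diff_cancel_left' diff_le_eq invol less_imp_le less_diff_eq mult_2 linorder_not_le nle_le)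
      then show ?thesis
        using F_pos[OF that] by (auto simp: G_def indicator_def)
    qed
    have "0 \<le> G y" if "y \<noteq> x" "y \<noteq> \<sigma> x" for y
    proof (cases "y \<bullet> v" b rule: linorder_cases)
      case less
      then show ?thesis using low that by blast
    next
      case equal
      then have "\<sigma> y = y" by (simp add: \<sigma>_def hyperplane_reflection_def)
      then show ?thesis by (simp add: G_def)
    next
      case greater
      \<comment> \<open>G is a product of two functions odd under \<sigma>, hence invariant, so this
        side reduces to the other one.\<close>
      then have "0 \<le> G (\<sigma> y)"
        using that \<sigma>_inner[of y] by (intro low) (auto, metis invol)
      then show ?thesis by (simp add: G_def odd algebra_simps)
    qed
    moreover have "AE y in lborel. y \<noteq> x" "AE y in lborel. y \<noteq> \<sigma> x"
      by (rule AE_lborel_singleton)+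
    ultimately show "AE y in lborel. 0 \<le> G y"
      by (auto elim: eventually_elim2)
    show "open (U - {\<sigma> x})" using U(1) by (simp add: open_delete)
    show "U - {\<sigma> x} \<noteq> {}"
    proof
      assume "U - {\<sigma> x} = {}"
      then have "U = {\<sigma> x}" using U(2) by auto
      then show False using U(1) not_open_singleton by metis
    qed
    fix y assume "y \<in> U - {\<sigma> x}"
    then show "0 < G y"
      using U(3)[of y] F_pos[of y] by (simp add: G_def \<sigma>_def)
  qed
  ultimately show ?thesis by (simp add: \<sigma>_def)
qed

text \<open>The fold moves z to height 2 b - z . v, which cannot fall below the minimal height y . v
  of S.\<close>

lemma foldable_imp_ge:
  fixes S :: "'a::euclidean_space set"
  assumes v: "norm v = 1" and fold: "foldable S v b"
    and y: "y \<in> S" "\<And>z. z \<in> S \<Longrightarrow> y \<bullet> v \<le> z \<bullet> v"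
    and z: "z \<in> S"
  shows "(y \<bullet> v + z \<bullet> v) / 2 \<le> b"
proof (cases "b \<le> z \<bullet> v")
  case True
  then have "hyperplane_reflection v b z \<in> S"
    using fold z by (auto simp: foldable_def)
  from y(2)[OF this] show ?thesis
    by (simp add: hyperplane_reflection_inner[OF v])
next
  case False
  with y(2)[OF z] show ?thesis by simp
qed

lemma body_extent:
  fixes S :: "'a::euclidean_space set"
  assumes "body S"
  obtains y z where "y \<in> S" "z \<in> S" "\<And>w. w \<in> S \<Longrightarrow> y \<bullet> v \<le> w \<bullet> v \<and> w \<bullet> v \<le> z \<bullet> v"
proof -
  have c: "compact S" "S \<noteq> {}" "continuous_on S (\<lambda>w. w \<bullet> v)"
    using assms by (auto simp: body_imp_compact body_nonempty intro!: continuous_intros)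
  obtain y where "y \<in> S" "\<forall>w\<in>S. y \<bullet> v \<le> w \<bullet> v"
    using continuous_attains_inf[OF c] by blast
  moreover obtain z where "z \<in> S" "\<forall>w\<in>S. w \<bullet> v \<le> z \<bullet> v"
    using continuous_attains_sup[OF c] by blast
  ultimately show thesis using that by blast
qed

text \<open>Makes the \<open>Inf\<close> in \<open>fold_level\<close> a genuine infimum. Above the
  highest point the folded cap is empty; from below, the midpoint of the extent of S in direction v
  is a bound.\<close>

lemma fold_levels_bounds:
  fixes S :: "'a::euclidean_space set"
  assumes S: "body S" and v: "norm v = 1"
  shows "{a. \<forall>b\<ge>a. foldable S v b} \<noteq> {}" and "bdd_below {a. \<forall>b\<ge>a. foldable S v b}"
proof -
  obtain y z where yz: "y \<in> S" "z \<in> S" "\<And>w. w \<in> S \<Longrightarrow> y \<bullet> v \<le> w \<bullet> v \<and> w \<bullet> v \<le> z \<bullet> v"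
    by (rule body_extent[OF S, where v=v]) blast
  have "\<forall>b\<ge>z \<bullet> v + 1. foldable S v b"
    using yz(3) by (force simp: foldable_def)
  then show "{a. \<forall>b\<ge>a. foldable S v b} \<noteq> {}" by blast
  show "bdd_below {a. \<forall>b\<ge>a. foldable S v b}"
    by (rule bdd_belowI[of _ "(y \<bullet> v + z \<bullet> v) / 2"])
      (use foldable_imp_ge[OF v _ yz(1) _ yz(2)] yz(3) in auto)
qed

lemma fold_level_le:
  assumes "body S" and "norm v = 1" and "\<And>b. a \<le> b \<Longrightarrow> foldable S v b"
  shows "fold_level S v \<le> a"
  unfolding fold_level_altdef using assms by (intro cInf_lower fold_levels_bounds) auto

lemma fold_level_lessD:
  assumes "body S" and "norm v = 1" and "fold_level S v < c"
  obtains a where "a < c" "\<And>b. a \<le> b \<Longrightarrow> foldable S v b"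
  using cInf_lessD[OF fold_levels_bounds(1)[OF assms(1,2)], of c] assms(3)
  unfolding fold_level_altdef by auto

theorem k_center_in_min_unfolded_region:
  fixes S :: "'a::euclidean_space set"
  assumes cont: "continuous_on {0<..} k"
    and loc: "\<And>R. integrable lborel (\<lambda>z::'a. indicator (cball 0 R) z * k (norm z))"
    and k: "strict_antimono_on {0<..} k"
    and S: "body S" and x: "k_center k S x"
  shows "x \<in> min_unfolded_region S"
proof (rule ccontr)
  assume "x \<notin> min_unfolded_region S"
  then obtain v where v: "norm v = 1" and "fold_level S v < x \<bullet> v"
    by (auto simp: min_unfolded_region_def)
  then obtain a where a: "a < x \<bullet> v" "\<And>b. a \<le> b \<Longrightarrow> foldable S v b"
    using fold_level_lessD[OF S v] by blast
  obtain y z where yz: "y \<in> S" "z \<in> S" "\<And>w. w \<in> S \<Longrightarrow> y \<bullet> v \<le> w \<bullet> v \<and> w \<bullet> v \<le> z \<bullet> v"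
    by (rule body_extent[OF S, where v=v]) blast
  \<comment> \<open>With b strictly above a, the midpoint of the extent lies strictly below b, so
    the reflection throws a neighbourhood of the lowest point y above the highest point z and out of
    S.\<close>
  obtain b where b: "a < b" "b < x \<bullet> v" using a(1) dense by blast
  have "(y \<bullet> v + z \<bullet> v) / 2 \<le> a"
    using foldable_imp_ge[OF v a(2) yz(1) _ yz(2)] yz(3) by auto
  then have mid: "y \<bullet> v + z \<bullet> v < 2 * b" using b(1) by simp
  moreover have "y \<bullet> v \<le> z \<bullet> v" using yz by blast
  ultimately have ylt: "y \<bullet> v < b" "y \<bullet> v < 2 * b - z \<bullet> v" by linarith+
  have "open {w. w \<bullet> v < min b (2 * b - z \<bullet> v)}"
    by (intro open_Collect_less continuous_intros)
  from body_open_in_interior[OF S this yz(1)] ylt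
  obtain U where U: "open U" "U \<noteq> {}" "U \<subseteq> S \<inter> {w. w \<bullet> v < min b (2 * b - z \<bullet> v)}"
    by force
  have "potential k S x < potential k S (hyperplane_reflection v b x)"
  proof (rule potential_less_hyperplane_reflection[OF cont loc k body_imp_compact[OF S] v _ b(2) U(1,2)])
    show "foldable S v b" using a(2) b(1) by simp
    fix w assume "w \<in> U"
    then have w: "w \<in> S" "w \<bullet> v < b" "w \<bullet> v < 2 * b - z \<bullet> v" using U(3) by auto
    then have "z \<bullet> v < hyperplane_reflection v b w \<bullet> v"
      by (simp add: hyperplane_reflection_inner[OF v])
    with w yz(3) show "w \<in> S \<and> w \<bullet> v < b \<and> hyperplane_reflection v b w \<notin> S"
      by (meson linorder_not_le)
  qed
  with x show False by (auto simp: k_center_def not_less[symmetric])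
qed

subsection \<open>Existence of centers\<close>

text \<open>After adding a constant to make \<open>k\<close> nonnegative on the relevant range, upper
  semicontinuity of the potential is reverse Fatou applied to \<open>1\<^sub>S (x\<^sub>n - z) k |z|\<close>.\<close>

lemma potential_limsup:
  fixes S :: "'a::euclidean_space set"
  assumes cont: "continuous_on {0<..} k"
    and loc: "\<And>R. integrable lborel (\<lambda>z::'a. indicator (cball 0 R) z * k (norm z))"
    and k: "antimono_on {0<..} k"
    and S: "compact S" and x: "x \<longlonglongrightarrow> l" and lim: "(\<lambda>n. potential k S (x n)) \<longlonglongrightarrow> c"
  shows "c \<le> potential k S l"
proof -
  have "bounded (range x)"
    using x by (simp add: convergent_imp_bounded)
  then obtain B1 where B1: "\<And>n. norm (x n) \<le> B1"
    unfolding bounded_iff by auto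
  have B1l: "norm l \<le> B1"
    using tendsto_norm[OF x] B1 by (intro LIMSEQ_le_const2[of "\<lambda>n. norm (x n)"]) auto
  obtain B2 where B2: "\<And>y. y \<in> S \<Longrightarrow> norm y \<le> B2"
    using compact_imp_bounded[OF S] by (auto simp: bounded_iff)
  \<comment> \<open>R exceeds all distances from the points x n and l to S, so the cutoff at R loses
    nothing. Since k decreases, k + c0 >= 0 at positive radii up to R; h is set to 0 at the origin,
    where the sign of k is unknown.\<close>
  define R where "R = \<bar>B1\<bar> + \<bar>B2\<bar> + 1"
  have R: "0 < R" by (simp add: R_def)
  define c0 where "c0 = \<bar>k R\<bar>"
  define h where "h z = (if z = 0 then 0 else indicator (cball 0 R) z * (k (norm z) + c0))" for z :: 'a
  have h_nonneg: "0 \<le> h z" for z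
    using monotone_onD[OF k, of "norm z" R] R by (auto simp: h_def indicator_def c0_def)
  have Sm [measurable]: "S \<in> sets borel" using S by (simp add: compact_imp_closed borel_closed)
  have hint0: "integrable lborel (\<lambda>z::'a. indicator (cball 0 R) z * k (norm z) + c0 * indicator (cball 0 R) z)"
    using emeasure_bounded_finite[of "cball 0 R :: 'a set"]
    by (intro Bochner_Integration.integrable_add loc integrable_mult_right) auto
  have AEh: "AE z in lborel. h z = indicator (cball 0 R) z * k (norm z) + c0 * indicator (cball 0 R) z"
    using AE_lborel_singleton[of "0::'a"] by eventually_elim (auto simp: h_def algebra_simps)
  have hm0: "(\<lambda>z::'a. indicator (cball 0 R) z * (k (norm z) + c0)) \<in> borel_measurable borel"
    using borel_measurable_radial[OF cont, where 'a='a]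
    by (intro borel_measurable_times borel_measurable_add borel_measurable_indicator) auto
  have hm [measurable]: "h \<in> borel_measurable borel"
    unfolding h_def using hm0 by measurable
  have hint: "integrable lborel h"
    using integrable_cong_AE[THEN iffD2, OF _ _ AEh hint0] hm borel_measurable_integrable[OF hint0]
    by simp
  have shift: "integrable lborel (\<lambda>z. indicator S (y - z) * h z)"
      "(\<integral>z. indicator S (y - z) * h z \<partial>lborel) = potential k S y + c0 * measure lborel S"
    if y: "norm y \<le> B1" for y
  proof -
    have Sint: "integrable lborel (indicator S :: 'a \<Rightarrow> real)"
      using emeasure_compact_finite[OF S] by auto
    have int: "integrable lborel (\<lambda>w. indicator S w * k (norm (y - w)) + c0 * indicator S w)"
      by (intro Bochner_Integration.integrable_add integrable_potential[OF cont loc S]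
          integrable_mult_right Sint)
    have val: "(\<integral>w. indicator S w * k (norm (y - w)) + c0 * indicator S w \<partial>lborel)
        = potential k S y + c0 * measure lborel S"
      by (subst Bochner_Integration.integral_add)
        (auto intro!: integrable_potential[OF cont loc S] integrable_mult_right Sint
          simp: potential_altdef)
    have flip: "has_bochner_integral lborel (\<lambda>z. g (y - z)) (integral\<^sup>L lborel g)"
      if g: "integrable lborel g" for g :: "'a \<Rightarrow> real"
    proof -
      have eq: "distr lborel borel (\<lambda>z::'a. y - z) = lborel"
        using lborel_affine[of "-1" y] by (simp add: density_1)
      have "integrable lborel (\<lambda>z. g (y - z))"
        using integrable_distr[of "\<lambda>z. y - z" lborel borel g] g by (simp add: eq)
      moreover have "integral\<^sup>L lborel g = (\<integral>z. g (y - z) \<partial>lborel)"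
        using g by (subst eq[symmetric], subst integral_distr) auto
      ultimately show ?thesis by (simp add: has_bochner_integral_iff)
    qed
    have AE: "AE z in lborel. indicator S (y - z) * h z
        = indicator S (y - z) * k (norm (y - (y - z))) + c0 * indicator S (y - z)"
      using AE_lborel_singleton[of "0::'a"]
    proof eventually_elim
      case (elim z)
      have "norm z \<le> R" if "y - z \<in> S"
        using B2[OF that] y norm_triangle_ineq4[of y "y - z"] by (simp add: R_def)
      then show ?case using elim by (auto simp: h_def indicator_def)
    qed
    have m: "(\<lambda>z. indicator S (y - z) * h z) \<in> borel_measurable lborel" by measurable
    note bo = flip[OF int, unfolded has_bochner_integral_iff]
    show "integrable lborel (\<lambda>z. indicator S (y - z) * h z)"
      using integrable_cong_AE[THEN iffD2, OF m _ AE] bo by blast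
    show "(\<integral>z. indicator S (y - z) * h z \<partial>lborel) = potential k S y + c0 * measure lborel S"
      using integral_cong_AE[OF m _ AE] bo val by auto
  qed
  have nn: "(\<integral>\<^sup>+z. ennreal (indicator S (y - z) * h z) \<partial>lborel)
      = ennreal (potential k S y + c0 * measure lborel S)" if "norm y \<le> B1" for y
    using shift[OF that] h_nonneg by (subst nn_integral_eq_integral) auto
  have nonneg: "0 \<le> potential k S y + c0 * measure lborel S" if "norm y \<le> B1" for y
    using shift(2)[OF that] h_nonneg by (metis (no_types, lifting) Bochner_Integration.integral_nonneg indicator_pos_le mult_nonneg_nonneg)
  have "limsup (\<lambda>n. \<integral>\<^sup>+z. ennreal (indicator S (x n - z) * h z) \<partial>lborel)
      \<le> (\<integral>\<^sup>+z. limsup (\<lambda>n. ennreal (indicator S (x n - z) * h z)) \<partial>lborel)"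
  proof (rule nn_integral_limsup[where w="\<lambda>z. ennreal (h z)"])
    show "AE z in lborel. ennreal (indicator S (x i - z) * h z) \<le> ennreal (h z)" for i
      using h_nonneg by (intro AE_I2 ennreal_leI) (auto simp: indicator_def)
    show "(\<integral>\<^sup>+z. ennreal (h z) \<partial>lborel) < \<infinity>"
      using hint h_nonneg by (simp add: nn_integral_eq_integral)
  qed measurable
  also have "\<dots> \<le> (\<integral>\<^sup>+z. ennreal (indicator S (l - z) * h z) \<partial>lborel)"
  proof (rule nn_integral_mono)
    fix z :: 'a
    show "limsup (\<lambda>n. ennreal (indicator S (x n - z) * h z)) \<le> ennreal (indicator S (l - z) * h z)"
    proof (cases "l - z \<in> S")
      case True
      have "\<forall>n. ennreal (indicator S (x n - z) * h z) \<le> ennreal (indicator S (l - z) * h z)"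
        using h_nonneg True by (intro allI ennreal_leI) (auto simp: indicator_def)
      then show ?thesis by (intro Limsup_bounded always_eventually)
    next
      case False
      \<comment> \<open>Closedness of S makes its indicator upper semicontinuous: off S the terms
        are eventually 0.\<close>
      have "open (- S)" using S by (simp add: compact_imp_closed open_Compl)
      moreover have "(\<lambda>n. x n - z) \<longlonglongrightarrow> l - z" using x by (intro tendsto_intros)
      ultimately have "eventually (\<lambda>n. x n - z \<in> - S) sequentially"
        using False by (intro topological_tendstoD) auto
      then have "eventually (\<lambda>n. ennreal (indicator S (x n - z) * h z) \<le> 0) sequentially"
        by eventually_elim simp
      from Limsup_bounded[OF this] show ?thesis
        using order_trans zero_le by blast
    qed
  qed
  finally have "limsup (\<lambda>n. ennreal (potential k S (x n) + c0 * measure lborel S))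
      \<le> ennreal (potential k S l + c0 * measure lborel S)"
    using nn[OF B1] nn[OF B1l] by simp
  moreover have "(\<lambda>n. ennreal (potential k S (x n) + c0 * measure lborel S))
      \<longlonglongrightarrow> ennreal (c + c0 * measure lborel S)"
    by (intro tendsto_ennrealI tendsto_intros lim)
  then have "limsup (\<lambda>n. ennreal (potential k S (x n) + c0 * measure lborel S))
      = ennreal (c + c0 * measure lborel S)"
    by (intro lim_imp_Limsup) auto
  \<comment> \<open>The right-hand side must be known to be nonnegative before
    \<open>ennreal\<close> can be stripped from the inequality.\<close>
  ultimately show ?thesis
    using nonneg[OF B1l] by (simp add: ennreal_le_iff)
qed

text \<open>For all y in the ball the translates of S lie in one ball about 0, so the integral of
  |k| over that ball is a uniform bound.\<close>

lemma potential_bdd_above: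
  fixes S :: "'a::euclidean_space set"
  assumes cont: "continuous_on {0<..} k"
    and loc: "\<And>R. integrable lborel (\<lambda>z::'a. indicator (cball 0 R) z * k (norm z))"
    and S: "compact S"
  shows "bdd_above (potential k S ` cball 0 B)"
proof -
  obtain B2 where B2: "\<And>y. y \<in> S \<Longrightarrow> norm y \<le> B2"
    using compact_imp_bounded[OF S] by (auto simp: bounded_iff)
  let ?R = "B + B2"
  let ?h = "\<lambda>z::'a. \<bar>indicator (cball 0 ?R) z * k (norm z)\<bar>"
  have hint: "integrable lborel ?h"
    using loc by (rule integrable_abs)
  have "potential k S y \<le> integral\<^sup>L lborel ?h" if y: "norm y \<le> B" for y
  proof -
    have eq: "distr lborel borel (\<lambda>z::'a. y - z) = lborel"
      using lborel_affine[of "-1" y] by (simp add: density_1)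
    have i: "integrable lborel (\<lambda>z. ?h (y - z))"
      using integrable_distr[of "\<lambda>z. y - z" lborel borel ?h] hint by (simp add: eq)
    have "potential k S y \<le> (\<integral>z. ?h (y - z) \<partial>lborel)"
      unfolding potential_altdef
    proof (intro integral_mono integrable_potential[OF cont loc S] i)
      fix z :: 'a
      have "norm (y - z) \<le> ?R" if "z \<in> S"
        using B2[OF that] y norm_triangle_ineq4[of y z] by simp
      then show "indicator S z * k (norm (y - z)) \<le> ?h (y - z)"
        by (auto simp: indicator_def)
    qed
    also have "\<dots> = integral\<^sup>L lborel ?h"
      using hint by (subst (2) eq[symmetric], subst integral_distr) auto
    finally show ?thesis .
  qed
  then show ?thesis by (auto intro!: bdd_aboveI)
qed

text \<open>A maximizing sequence in a ball containing S has a convergent subsequence, and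
  semicontinuity makes its limit a maximum over the ball. A point outside the ball is improved by a
  reflection into it.\<close>

theorem k_center_exists:
  fixes S :: "'a::euclidean_space set"
  assumes cont: "continuous_on {0<..} k"
    and loc: "\<And>R. integrable lborel (\<lambda>z::'a. indicator (cball 0 R) z * k (norm z))"
    and k: "strict_antimono_on {0<..} k"
    and S: "body S"
  shows "\<exists>x. k_center k S x"
proof -
  have comp: "compact S" using S by (rule body_imp_compact)
  have anti: "antimono_on {0<..} k"
  proof (rule monotone_onI)
    fix x y :: real assume "x \<in> {0<..}" "y \<in> {0<..}" "x \<le> y"
    then show "k y \<le> k x" using monotone_onD[OF k, of x y] by (cases "x = y") auto
  qed
  obtain B where B: "\<And>y. y \<in> S \<Longrightarrow> norm y \<le> B" "0 < B"
    using compact_imp_bounded[OF comp] by (auto simp: bounded_pos)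
  define M where "M = Sup (potential k S ` cball 0 B)"
  have bdd: "bdd_above (potential k S ` cball 0 B)"
    by (rule potential_bdd_above[OF cont loc comp])
  have "M \<in> closure (potential k S ` cball 0 B)"
    unfolding M_def using B(2) bdd by (intro closure_contains_Sup) auto
  then obtain p where p: "\<And>n. p n \<in> potential k S ` cball 0 B" "p \<longlonglongrightarrow> M"
    by (auto simp: closure_sequential)
  then have "\<forall>n. \<exists>x. x \<in> cball 0 B \<and> p n = potential k S x" by blast
  then obtain x where x: "\<And>n. x n \<in> cball 0 B" "\<And>n. p n = potential k S (x n)"
    by metis
  have "compact (cball (0::'a) B)" by simp
  then obtain l r where lr: "l \<in> cball 0 B" "strict_mono r" "(x \<circ> r) \<longlonglongrightarrow> l"
    using x(1) unfolding compact_def by metis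
  have "M \<le> potential k S l"
  proof (rule potential_limsup[OF cont loc anti comp lr(3)])
    show "(\<lambda>n. potential k S ((x \<circ> r) n)) \<longlonglongrightarrow> M"
      using LIMSEQ_subseq_LIMSEQ[OF p(2) lr(2)] by (simp add: x(2) comp_def)
  qed
  then have max: "potential k S z \<le> potential k S l" if "z \<in> cball 0 B" for z
    using cSup_upper[OF imageI[OF that] bdd] by (force simp: M_def)
  have "potential k S z \<le> potential k S l" for z
  proof (cases "z \<in> cball 0 B")
    case True
    then show ?thesis by (rule max)
  next
    case False
    then have z: "B < norm z" by simp
    define v where "v = z /\<^sub>R norm z"
    \<comment> \<open>Halfway between B and |z| in the direction of z: the reflection sends z to its
      radial projection on the sphere of radius B. S lies entirely below the hyperplane, and its
      mirror image lies outside the ball.\<close>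
    define b where "b = (norm z + B) / 2"
    have v: "norm v = 1" "z \<bullet> v = norm z"
      using z B(2) by (auto simp: v_def dot_square_norm power2_eq_square field_simps)
    have below: "y \<bullet> v \<le> B" if "y \<in> S" for y
      using B(1)[OF that] norm_cauchy_schwarz[of y v] v(1) by simp
    have refl: "hyperplane_reflection v b z \<in> cball 0 B"
    proof -
      have "hyperplane_reflection v b z = z - (norm z - B) *\<^sub>R v"
        by (simp add: hyperplane_reflection_def v(2) b_def add_divide_distrib)
      also have "\<dots> = (1 - (norm z - B) / norm z) *\<^sub>R z"
        by (simp add: v_def scaleR_left_diff_distrib divide_inverse)
      also have "1 - (norm z - B) / norm z = B / norm z"
        using z B(2) by (auto simp: diff_divide_distrib)
      finally have "hyperplane_reflection v b z = (B / norm z) *\<^sub>R z" .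
      then show ?thesis using z B(2) by simp
    qed
    obtain s where "s \<in> S" using body_nonempty[OF S] by blast
    then obtain U where U: "open U" "U \<noteq> {}" "U \<subseteq> S"
      using body_open_in_interior[OF S open_UNIV] by auto
    have "potential k S z < potential k S (hyperplane_reflection v b z)"
    proof (rule potential_less_hyperplane_reflection[OF cont loc k comp v(1) _ _ U(1,2)])
      show "b < z \<bullet> v" using z v(2) by (simp add: b_def)
      show "foldable S v b" using below z by (fastforce simp: foldable_def b_def)
      fix y assume "y \<in> U"
      then have y: "y \<in> S" using U(3) by auto
      moreover have "y \<bullet> v < b" using below[OF y] z by (simp add: b_def)
      moreover have "B < hyperplane_reflection v b y \<bullet> v"
        using below[OF y] z by (simp add: hyperplane_reflection_inner[OF v(1)] b_def add_divide_distrib)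
      then have "hyperplane_reflection v b y \<notin> S" using below by force
      ultimately show "y \<in> S \<and> y \<bullet> v < b \<and> hyperplane_reflection v b y \<notin> S" by simp
    qed
    then show ?thesis using max[OF refl] by linarith
  qed
  then show ?thesis by (auto simp: k_center_def)
qed

subsection \<open>Geometry of the solid of revolution\<close>

lemma concave_on_min_le:
  fixes f :: "real \<Rightarrow> real"
  assumes "concave_on A f" and "x \<in> A" "z \<in> A" and "x \<le> y" "y \<le> z"
  shows "min (f x) (f z) \<le> f y"
proof (cases "x = z")
  case False
  define t where "t = (y - x) / (z - x)"
  have t: "0 \<le> t" "t \<le> 1" using assms False by (auto simp: t_def field_simps)
  have "(1 - t) *\<^sub>R x + t *\<^sub>R z = x + t * (z - x)" by (simp add: algebra_simps)
  also have "\<dots> = y" using False by (simp add: t_def)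
  finally have y: "(1 - t) *\<^sub>R x + t *\<^sub>R z = y" .
  have "(1 - t) * min (f x) (f z) + t * min (f x) (f z) \<le> (1 - t) * f x + t * f z"
    using t by (intro add_mono mult_left_mono) auto
  also have "\<dots> \<le> f y"
    using concave_onD[OF assms(1) t assms(2,3)] by (simp only: y)
  finally show ?thesis by (simp add: algebra_simps)
qed (use assms in auto)

text \<open>Both a + d and b lie on the segment from a to b + d, with complementary weights; adding
  the two concavity inequalities gives the claim.\<close>

lemma concave_on_diff_mono:
  fixes f :: "real \<Rightarrow> real"
  assumes "concave_on A f" and "a \<in> A" "b + d \<in> A" and "a \<le> b" "0 \<le> d"
  shows "f (b + d) - f b \<le> f (a + d) - f a"
proof (cases "b + d = a")
  case False
  define t where "t = d / (b + d - a)"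
  have t: "0 \<le> t" "t \<le> 1" "0 \<le> 1 - t" "1 - t \<le> 1"
    using assms False by (auto simp: t_def field_simps)
  have td: "t * (b + d - a) = d" using False by (simp add: t_def)
  have e1: "(1 - t) *\<^sub>R a + t *\<^sub>R (b + d) = a + d"
    using td by (simp add: algebra_simps)
  have e2: "(1 - (1 - t)) *\<^sub>R a + (1 - t) *\<^sub>R (b + d) = b"
    using td by (simp add: algebra_simps)
  show ?thesis
    using concave_onD[OF assms(1) t(1,2) assms(2,3)] concave_onD[OF assms(1) t(3,4) assms(2,3)]
    unfolding e1 e2 by (simp add: algebra_simps)
next
  case True
  then have "b = a" "d = 0" using assms by auto
  then show ?thesis by simp
qed

lemma mem_solid_of_revolution:
  "(t, y) \<in> solid_of_revolution \<omega> \<longleftrightarrow> 0 \<le> t \<and> t \<le> 1 \<and> norm y \<le> \<omega> t"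
  by (simp add: solid_of_revolution_def)

lemma hyperplane_reflection_Pair:
  "hyperplane_reflection (v, w) b (t, y)
    = (t - 2 * (t * v + y \<bullet> w - b) * v, y - (2 * (t * v + y \<bullet> w - b)) *\<^sub>R w)"
  by (simp add: hyperplane_reflection_def)

text \<open>The hyperplane is parallel to the axis, with the axis on its lower side or in it. The
  reflection keeps the height and does not increase the distance to the axis, so each slice, a ball,
  is folded into itself.\<close>

lemma foldable_solid_of_revolution_orthogonal:
  fixes w :: "'b::euclidean_space"
  assumes "norm w = 1" and "0 \<le> b"
  shows "foldable (solid_of_revolution \<omega>) (0, w) b"
  unfolding foldable_def
proof (intro ballI impI)
  fix z :: "real \<times> 'b"
  assume z: "z \<in> solid_of_revolution \<omega>" "b \<le> z \<bullet> (0, w)"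
  obtain t y where ty: "z = (t, y)" by force
  let ?q = "y \<bullet> w - b"
  have "(norm (y - (2 * ?q) *\<^sub>R w))\<^sup>2 = (norm y)\<^sup>2 - 4 * ?q * b"
    using norm_diff_hyperplane_reflection_sq[OF assms(1), of b y 0]
    by (simp add: hyperplane_reflection_def algebra_simps)
  also have "\<dots> \<le> (norm y)\<^sup>2" using z(2) assms(2) by (simp add: ty)
  finally have "norm (y - (2 * ?q) *\<^sub>R w) \<le> norm y" by (rule power2_le_imp_le) simp
  then show "hyperplane_reflection (0, w) b z \<in> solid_of_revolution \<omega>"
    using z(1) by (simp add: ty hyperplane_reflection_Pair mem_solid_of_revolution)
qed

lemma min_unfolded_regionD:
  "x \<in> min_unfolded_region S \<Longrightarrow> norm v = 1 \<Longrightarrow> x \<bullet> v \<le> fold_level S v"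
  by (auto simp: min_unfolded_region_def)

lemma min_unfolded_region_segment:
  assumes "(s1, 0) \<in> min_unfolded_region S" "(s2, 0) \<in> min_unfolded_region S"
    and "s1 \<le> s" "s \<le> (s2 :: real)"
  shows "(s, 0) \<in> min_unfolded_region S"
  unfolding min_unfolded_region_def
proof (intro INT_I CollectI)
  fix v :: "real \<times> 'a" assume v: "v \<in> sphere 0 1"
  obtain v1 v2 where vv: "v = (v1, v2)" by force
  have le: "s1 * v1 \<le> fold_level S v" "s2 * v1 \<le> fold_level S v"
    using min_unfolded_regionD[OF assms(1), of v] min_unfolded_regionD[OF assms(2), of v] v vv by auto
  have "s * v1 \<le> max (s1 * v1) (s2 * v1)"
    using assms(3,4) by (cases "0 \<le> v1") (auto simp: le_max_iff_disj mult_right_mono mult_right_mono_neg)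
  then show "(s, 0) \<bullet> v \<le> fold_level S v" using le by (simp add: vv)
qed

section \<open>Quasi-concavity of the radius and the position of the minimal unfolded region\<close>

context
  fixes \<omega> :: "real \<Rightarrow> real" and \<Omega> :: "(real \<times> 'b::euclidean_space) set"
  assumes nonneg: "\<And>t. t \<in> {0..1} \<Longrightarrow> 0 \<le> \<omega> t"
    and conc: "concave_on {0..1} (\<lambda>t. \<omega> t ^ DIM('b))"
    and \<Omega>: "\<Omega> = solid_of_revolution \<omega>" and bd: "body \<Omega>"
begin

lemma radius_power_le_iff:
  "x \<in> {0..1} \<Longrightarrow> y \<in> {0..1} \<Longrightarrow> \<omega> x ^ DIM('b) \<le> \<omega> y ^ DIM('b) \<longleftrightarrow> \<omega> x \<le> \<omega> y"
  using nonneg by (simp add: power_mono_iff)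

text \<open>Quasi-concavity passes from the power of \<omega> to \<omega> itself, since powers are
  monotone on nonnegative numbers.\<close>

lemma radius_min_le:
  assumes "0 \<le> x" "x \<le> y" "y \<le> z" "z \<le> 1"
  shows "\<omega> x \<le> \<omega> y \<or> \<omega> z \<le> \<omega> y"
  using concave_on_min_le[OF conc, of x z y] assms radius_power_le_iff[of x y] radius_power_le_iff[of z y]
  by (auto simp: min_le_iff_disj)

text \<open>A quasi-concave function that has once strictly descended never rises again;
  \<open>radius_mono_before\<close> is the mirror image.\<close>

lemma radius_antimono_after:
  assumes "0 \<le> x" "x < y" "\<omega> y < \<omega> x" "y \<le> p" "p \<le> q" "q \<le> 1"
  shows "\<omega> q \<le> \<omega> p"
  using radius_min_le[of x y p] radius_min_le[of x p q] assms by auto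

lemma radius_mono_before:
  assumes "y \<le> 1" "x < y" "\<omega> x < \<omega> y" "q \<le> x" "p \<le> q" "0 \<le> p"
  shows "\<omega> p \<le> \<omega> q"
  using radius_min_le[of q x y] radius_min_le[of p q y] assms by auto

text \<open>A body contains an open set, so \<omega> a > 0 for some a. The inner point t lies
  strictly between a and an endpoint e of the interval, and concavity along that chord makes
  \<omega> t positive.\<close>

lemma radius_pos:
  assumes "0 < t" "t < 1"
  shows "0 < \<omega> t"
proof (rule ccontr)
  assume "\<not> 0 < \<omega> t"
  then have t0: "\<omega> t = 0" using nonneg[of t] assms by auto
  obtain U where U: "open U" "U \<noteq> {}" "\<Omega> = closure U" using bd by (auto simp: body_def)
  have U\<Omega>: "U \<subseteq> \<Omega>" using U closure_subset by blast
  obtain z where z: "z \<in> U" using U by blast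
  obtain a y where ay: "z = (a, y)" by force
  obtain A B where AB: "open A" "open B" "a \<in> A" "y \<in> B" "A \<times> B \<subseteq> U"
    using U(1) z ay by (metis mem_Sigma_iff open_prod_elim)
  \<comment> \<open>An open set of cross-section vectors contains a nonzero one, so the slice at a
    has positive radius.\<close>
  have "B \<noteq> {0}" using AB(2) not_open_singleton by metis
  then obtain y' where y': "y' \<in> B" "y' \<noteq> 0" using AB(4) by blast
  then have "(a, y') \<in> \<Omega>" using AB U\<Omega> by blast
  then have a: "0 \<le> a" "a \<le> 1" "0 < \<omega> a"
    using y' unfolding \<Omega> mem_solid_of_revolution by (auto intro: less_le_trans[of _ "norm y'"])
  have zero: "\<omega> b = 0" if "0 \<le> b" "b \<le> 1" "b < t \<longleftrightarrow> t < a" for b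
  proof (rule ccontr)
    assume "\<omega> b \<noteq> 0"
    then have b: "0 < \<omega> b" using nonneg[of b] that by auto
    have "t \<noteq> a" using t0 a by auto
    then show False
      using radius_min_le[of a t b] radius_min_le[of b t a] that a b t0 assms by force
  qed
  define e where "e = (if t < a then 0 else 1 :: real)"
  have e: "0 \<le> e" "e \<le> 1" "e < t \<longleftrightarrow> t < a" using assms by (auto simp: e_def)
  have we: "\<omega> e = 0" using zero e by blast
  have ta: "t \<noteq> a" using t0 a by auto
  define l where "l = (t - e) / (a - e)"
  have ne: "a \<noteq> e" using a we by auto
  have l: "0 < l" "l \<le> 1"
    using ta e a assms ne by (auto simp: l_def e_def divide_simps split: if_splits)
  have "(1 - l) *\<^sub>R e + l *\<^sub>R a = e + l * (a - e)" by (simp add: algebra_simps)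
  also have "\<dots> = t" using ne by (simp add: l_def)
  finally have "(1 - l) * \<omega> e ^ DIM('b) + l * \<omega> a ^ DIM('b) \<le> \<omega> t ^ DIM('b)"
    using concave_onD[OF conc, of l e a] l e a by simp
  then have "l * \<omega> a ^ DIM('b) \<le> 0"
    using we t0 by (simp add: zero_power)
  moreover have "0 < l * \<omega> a ^ DIM('b)" using l a by simp
  ultimately show False by simp
qed

text \<open>The direction from the axis towards the point is orthogonal to the axis and therefore
  has fold level at most 0, while the point has height |y| in it.\<close>

lemma min_unfolded_region_on_axis:
  assumes "(s, y) \<in> min_unfolded_region \<Omega>"
  shows "y = 0"
proof (rule ccontr)
  assume y: "y \<noteq> 0"
  define w where "w = y /\<^sub>R norm y"
  have w: "norm w = 1" using y by (simp add: w_def)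
  have "norm y = (s, y) \<bullet> (0, w)"
    using y by (simp add: w_def dot_square_norm power2_eq_square)
  also have "\<dots> \<le> fold_level \<Omega> (0, w)"
    using assms w by (intro min_unfolded_regionD) (auto simp: norm_Pair)
  also have "\<dots> \<le> 0"
    using w by (intro fold_level_le[OF bd]) (auto simp: \<Omega> norm_Pair foldable_solid_of_revolution_orthogonal)
  finally show False using y by simp
qed

text \<open>A hyperplane at or beyond an end of the solid folds at most the end slice, which it then
  fixes pointwise.\<close>

lemma min_unfolded_region_range:
  assumes "(s, 0) \<in> min_unfolded_region \<Omega>"
  shows "0 \<le> s" "s \<le> 1"
proof -
  have "foldable \<Omega> (1, 0) b" if b: "1 \<le> b" for b
    unfolding foldable_def
  proof (intro ballI impI)
    fix z assume z: "z \<in> \<Omega>" "b \<le> z \<bullet> (1, 0)"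
    obtain t y where ty: "z = (t, y)" by force
    have "t = 1" "b = 1" using z b by (auto simp: ty \<Omega> mem_solid_of_revolution)
    then show "hyperplane_reflection (1, 0) b z \<in> \<Omega>"
      using z(1) by (simp add: ty hyperplane_reflection_Pair)
  qed
  then have "fold_level \<Omega> (1, 0) \<le> 1"
    by (intro fold_level_le[OF bd]) (auto simp: norm_Pair)
  then show "s \<le> 1"
    using min_unfolded_regionD[OF assms, of "(1, 0)"] by (simp add: norm_Pair)
  have "foldable \<Omega> (- 1, 0) b" if b: "0 \<le> b" for b
    unfolding foldable_def
  proof (intro ballI impI)
    fix z assume z: "z \<in> \<Omega>" "b \<le> z \<bullet> (- 1, 0)"
    obtain t y where ty: "z = (t, y)" by force
    have "t = 0" "b = 0" using z b by (auto simp: ty \<Omega> mem_solid_of_revolution)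
    then show "hyperplane_reflection (- 1, 0) b z \<in> \<Omega>"
      using z(1) by (simp add: ty hyperplane_reflection_Pair)
  qed
  then have "fold_level \<Omega> (- 1, 0) \<le> 0"
    by (intro fold_level_le[OF bd]) (auto simp: norm_Pair)
  then show "0 \<le> s"
    using min_unfolded_regionD[OF assms, of "(- 1, 0)"] by (simp add: norm_Pair)
qed

text \<open>As s does not exceed the fold level, folding fails at some level b above any chosen a <
  s. Failure means that \<omega> is strictly larger at t than at the mirror height 2 b - t. That
  height lies beyond q, so \<omega> has been increasing up to there.\<close>

lemma radius_mono_reflected_right:
  assumes s: "(s, 0) \<in> min_unfolded_region \<Omega>" "1 / 2 < s" and pq: "0 \<le> p" "p \<le> q" "q < 2 * s - 1"
  shows "\<omega> p \<le> \<omega> q"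
proof -
  \<comment> \<open>For b >= a and t <= 1 the bound (q + 1) / 2 < a puts 2 b - t above q, and 1 / 2
    < a keeps it in the unit interval.\<close>
  obtain a where a: "max (1 / 2) ((q + 1) / 2) < a" "a < s"
    using dense[of "max (1 / 2) ((q + 1) / 2)" s] assms by auto
  have "s \<le> fold_level \<Omega> (1, 0)"
    using min_unfolded_regionD[OF s(1), of "(1, 0)"] by (simp add: norm_Pair)
  then have "\<not> (\<forall>b. a \<le> b \<longrightarrow> foldable \<Omega> (1, 0) b)"
    using fold_level_le[OF bd, of "(1, 0)" a] a by (force simp: norm_Pair)
  then obtain b t y where b: "a \<le> b" and ty: "(t, y) \<in> \<Omega>" "b \<le> t" "(2 * b - t, y) \<notin> \<Omega>"
    by (auto simp: foldable_def hyperplane_reflection_Pair)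
  have lt: "\<omega> (2 * b - t) < \<omega> t"
    using ty b a by (auto simp: \<Omega> mem_solid_of_revolution)
  then have "2 * b - t < t" using ty(2) by (cases "b = t") auto
  from radius_mono_before[OF _ this lt _ pq(2,1)] show ?thesis
    using ty b a by (auto simp: \<Omega> mem_solid_of_revolution)
qed

text \<open>Mirror image of \<open>radius_mono_reflected_right\<close>: level b in direction (-1, 0)
  is the hyperplane at height -b, so t is reflected to - t - 2 b.\<close>

lemma radius_antimono_reflected_left:
  assumes s: "(s, 0) \<in> min_unfolded_region \<Omega>" "s < 1 / 2" and pq: "2 * s < p" "p \<le> q" "q \<le> 1"
  shows "\<omega> q \<le> \<omega> p"
proof -
  obtain c where c: "s < c" "c < min (1 / 2) (p / 2)"
    using dense[of s "min (1 / 2) (p / 2)"] assms by auto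
  have "- s \<le> fold_level \<Omega> (- 1, 0)"
    using min_unfolded_regionD[OF s(1), of "(- 1, 0)"] by (simp add: norm_Pair)
  then have "\<not> (\<forall>b. - c \<le> b \<longrightarrow> foldable \<Omega> (- 1, 0) b)"
    using fold_level_le[OF bd, of "(- 1, 0)" "- c"] c by (force simp: norm_Pair)
  then obtain b t y where b: "- c \<le> b" and ty: "(t, y) \<in> \<Omega>" "b \<le> - t" "(- t - b * 2, y) \<notin> \<Omega>"
    by (auto simp: foldable_def hyperplane_reflection_Pair algebra_simps)
  have lt: "\<omega> (- t - b * 2) < \<omega> t"
    using ty b c by (auto simp: \<Omega> mem_solid_of_revolution)
  then have "t < - t - b * 2" using ty(2) by (cases "b = - t") auto
  from radius_antimono_after[OF _ this lt _ pq(2,3)] show ?thesis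
    using ty b c by (auto simp: \<Omega> mem_solid_of_revolution)
qed

lemma generating_curve_in_frontier:
  assumes "t \<in> {0..1}" and "norm (e :: 'b) = 1"
  shows "(t, \<omega> t *\<^sub>R e) \<in> frontier \<Omega>"
proof -
  have "(t, \<omega> t *\<^sub>R e) \<in> \<Omega>"
    using assms nonneg[of t] by (simp add: \<Omega> mem_solid_of_revolution)
  moreover have "closed \<Omega>" using bd by (auto simp: body_def)
  moreover have "(t, \<omega> t *\<^sub>R e) \<notin> interior \<Omega>"
  proof
    assume "(t, \<omega> t *\<^sub>R e) \<in> interior \<Omega>"
    then obtain d where d: "0 < d" "ball (t, \<omega> t *\<^sub>R e) d \<subseteq> \<Omega>"
      by (auto simp: mem_interior)
    have "(t, (\<omega> t + d / 2) *\<^sub>R e) \<in> ball (t, \<omega> t *\<^sub>R e) d"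
      using d(1) assms(2) by (simp add: dist_Pair_Pair dist_norm flip: scaleR_left_diff_distrib)
    then have "(t, (\<omega> t + d / 2) *\<^sub>R e) \<in> \<Omega>" using d by blast
    then show False
      using d(1) assms nonneg[of t] by (simp add: \<Omega> mem_solid_of_revolution)
  qed
  ultimately show ?thesis by (simp add: frontier_def)
qed

text \<open>Places the distances of the slice estimates in the range where k'(r) / r is monotone.
  The supremum is finite because the minimal unfolded region lies in the unit segment of the axis
  and \<Omega> is compact.\<close>

lemma dist_generating_curve:
  assumes s: "(s, 0) \<in> min_unfolded_region \<Omega>" and t: "t \<in> {0..1}"
  shows "dist_min \<Omega> \<le> sqrt ((s - t)\<^sup>2 + (\<omega> t)\<^sup>2)" "sqrt ((s - t)\<^sup>2 + (\<omega> t)\<^sup>2) \<le> dist_max \<Omega>"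
proof -
  let ?D = "{norm (z - w) | z w. z \<in> min_unfolded_region \<Omega> \<and> w \<in> frontier \<Omega>}"
  obtain e :: 'b where e: "e \<in> Basis" by (meson nonempty_Basis ex_in_conv)
  then have e1: "norm e = 1" by (rule norm_Basis)
  have w: "(t, \<omega> t *\<^sub>R e) \<in> frontier \<Omega>"
    by (rule generating_curve_in_frontier[OF t e1])
  have "norm ((s, 0) - (t, \<omega> t *\<^sub>R e)) = sqrt ((s - t)\<^sup>2 + (\<omega> t)\<^sup>2)"
    using e1 by (simp add: norm_Pair)
  then have mem: "sqrt ((s - t)\<^sup>2 + (\<omega> t)\<^sup>2) \<in> ?D" using s w by force
  have "bdd_below ?D" by (rule bdd_belowI[of _ 0]) auto
  then show "dist_min \<Omega> \<le> sqrt ((s - t)\<^sup>2 + (\<omega> t)\<^sup>2)"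
    unfolding dist_min_def using mem by (intro cInf_lower)
  have c: "compact \<Omega>" using bd by (rule body_imp_compact)
  obtain B where B: "\<And>w. w \<in> \<Omega> \<Longrightarrow> norm w \<le> B"
    using compact_imp_bounded[OF c] by (auto simp: bounded_iff)
  have "bdd_above ?D"
  proof (rule bdd_aboveI)
    fix x assume "x \<in> ?D"
    then obtain z w where zw: "x = norm (z - w)" "z \<in> min_unfolded_region \<Omega>" "w \<in> frontier \<Omega>" by blast
    obtain a y where ay: "z = (a, y)" by force
    have "y = 0" "0 \<le> a" "a \<le> 1"
      using zw(2) min_unfolded_region_on_axis min_unfolded_region_range unfolding ay by blast+
    then have "norm z \<le> 1" by (simp add: ay norm_Pair)
    moreover have "norm w \<le> B"
      using zw(3) c B by (simp add: frontier_def compact_imp_closed)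
    ultimately show "x \<le> 1 + B" using norm_triangle_ineq4[of z w] zw(1) by simp
  qed
  then show "sqrt ((s - t)\<^sup>2 + (\<omega> t)\<^sup>2) \<le> dist_max \<Omega>"
    unfolding dist_max_def using mem by (intro cSup_upper)
qed

end

subsection \<open>Slices of the potential\<close>

text \<open>For \<open>0 < u\<close>, \<open>chord_diff k \<delta> u r\<close> compares the kernel at a point at height \<open>u\<close> above the
  midpoint of two sources \<open>\<plusminus>\<delta>\<close> on the axis, at distance \<open>r\<close> from the axis.\<close>

definition chord_diff :: "(real \<Rightarrow> real) \<Rightarrow> real \<Rightarrow> real \<Rightarrow> real \<Rightarrow> real" where
  "chord_diff k \<delta> u r = k (sqrt ((u - \<delta>)\<^sup>2 + r\<^sup>2)) - k (sqrt ((u + \<delta>)\<^sup>2 + r\<^sup>2))"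

text \<open>The \<open>itself\<close> argument carries the cross-section space, whose dimension no
  other argument determines.\<close>

definition slice_diff :: "'b::euclidean_space itself \<Rightarrow> (real \<Rightarrow> real) \<Rightarrow> real \<Rightarrow> real \<Rightarrow> real \<Rightarrow> real" where
  "slice_diff _ k \<delta> u \<rho> = (\<integral>y. indicator (cball (0 :: 'b) \<rho>) y * chord_diff k \<delta> u (norm y) \<partial>lborel)"

text \<open>Oddness in u later allows the integral over all heights to be folded onto u > 0.\<close>

lemma chord_diff_minus: "chord_diff k \<delta> (- u) r = - chord_diff k \<delta> u r"
  by (simp add: chord_diff_def power2_eq_square algebra_simps)

lemma slice_diff_minus: "slice_diff TYPE('b::euclidean_space) k \<delta> (- u) \<rho> = - slice_diff TYPE('b) k \<delta> u \<rho>"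
  by (simp add: slice_diff_def chord_diff_minus)

lemma slice_diff_0: "slice_diff TYPE('b::euclidean_space) k \<delta> u 0 = 0"
proof -
  have "AE y in lborel. indicator (cball (0 :: 'b) 0) y * chord_diff k \<delta> u (norm y) = 0"
    using AE_lborel_singleton[of "0 :: 'b"] by eventually_elim simp
  then show ?thesis
    unfolding slice_diff_def by (rule integral_eq_zero_AE)
qed

text \<open>For u > 0 the source at \<delta> is nearer than the one at -\<delta>; u different from
  \<delta> keeps the nearer distance positive even at r = 0.\<close>

lemma chord_diff_pos:
  assumes k: "strict_antimono_on {0<..} k" and "0 < u" "0 < \<delta>" "u \<noteq> \<delta>"
  shows "0 < chord_diff k \<delta> u r"
proof -
  have a: "0 < (u - \<delta>)\<^sup>2" using assms by simp
  have "(u - \<delta>)\<^sup>2 + 4 * (u * \<delta>) = (u + \<delta>)\<^sup>2" by (simp add: power2_eq_square algebra_simps)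
  moreover have "0 < u * \<delta>" using assms by simp
  ultimately have b: "(u - \<delta>)\<^sup>2 < (u + \<delta>)\<^sup>2" by linarith
  have "0 < (u - \<delta>)\<^sup>2 + r\<^sup>2" using a by (intro add_pos_nonneg) auto
  moreover have "(u - \<delta>)\<^sup>2 + r\<^sup>2 < (u + \<delta>)\<^sup>2 + r\<^sup>2" using b by simp
  ultimately show ?thesis
    using monotone_onD[OF k, of "sqrt ((u - \<delta>)\<^sup>2 + r\<^sup>2)" "sqrt ((u + \<delta>)\<^sup>2 + r\<^sup>2)"]
    by (simp add: chord_diff_def)
qed

text \<open>With p <= q the two distances, the derivative in r is r (k'(p)/p - k'(q)/q), and here
  the monotonicity of k'(r)/r acts. The near distance at \<open>r1\<close> and the far one at
  \<open>r2\<close> are the extremes, so only they need bounds.\<close>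

lemma chord_diff_antimono:
  assumes der: "\<And>r. 0 < r \<Longrightarrow> (k has_real_derivative k' r) (at r)"
    and mono: "\<And>x y. 0 < x \<Longrightarrow> lo \<le> x \<Longrightarrow> x \<le> y \<Longrightarrow> y \<le> hi \<Longrightarrow> k' x / x \<le> k' y / y"
    and u: "0 < u" "0 < \<delta>" "u \<noteq> \<delta>" and r: "0 \<le> r1" "r1 \<le> r2"
    and lo: "lo \<le> sqrt ((u - \<delta>)\<^sup>2 + r1\<^sup>2)" and hi: "sqrt ((u + \<delta>)\<^sup>2 + r2\<^sup>2) \<le> hi"
  shows "chord_diff k \<delta> u r2 \<le> chord_diff k \<delta> u r1"
proof (rule DERIV_nonpos_imp_nonincreasing[OF r(2)])
  fix r assume rr: "r1 \<le> r" "r \<le> r2"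
  let ?p = "sqrt ((u - \<delta>)\<^sup>2 + r\<^sup>2)" and ?q = "sqrt ((u + \<delta>)\<^sup>2 + r\<^sup>2)"
  have a: "0 < (u - \<delta>)\<^sup>2" using u by simp
  have "(u - \<delta>)\<^sup>2 + 4 * (u * \<delta>) = (u + \<delta>)\<^sup>2" by (simp add: power2_eq_square algebra_simps)
  moreover have "0 < u * \<delta>" using u by simp
  ultimately have b: "(u - \<delta>)\<^sup>2 < (u + \<delta>)\<^sup>2" by linarith
  have p0: "0 < (u - \<delta>)\<^sup>2 + r\<^sup>2" using a by (intro add_pos_nonneg) auto
  have q0: "0 < (u + \<delta>)\<^sup>2 + r\<^sup>2" using a b by (intro add_pos_nonneg) auto
  have pq: "0 < ?p" "0 < ?q" "?p \<le> ?q" using p0 q0 b by simp_all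
  have "sqrt ((u - \<delta>)\<^sup>2 + r1\<^sup>2) \<le> ?p" "?q \<le> sqrt ((u + \<delta>)\<^sup>2 + r2\<^sup>2)"
    using r rr by (auto intro!: power_mono)
  then have "lo \<le> ?p" "?q \<le> hi" using lo hi by linarith+
  then have "k' ?p / ?p \<le> k' ?q / ?q" using pq by (intro mono)
  then have "k' ?p / ?p * r \<le> k' ?q / ?q * r"
    using r rr by (intro mult_right_mono) auto
  then have le: "k' ?p * (r / ?p) - k' ?q * (r / ?q) \<le> 0" by simp
  have d: "((\<lambda>r. sqrt (c + r\<^sup>2)) has_real_derivative r / sqrt (c + r\<^sup>2)) (at r)"
    if "0 < c + r\<^sup>2" for c
    by (rule derivative_eq_intros refl | use that in \<open>simp add: field_simps\<close>)+
  have "((\<lambda>r. chord_diff k \<delta> u r) has_real_derivative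
      k' ?p * (r / ?p) - k' ?q * (r / ?q)) (at r)"
    unfolding chord_diff_def
    by (intro DERIV_diff DERIV_chain2[OF der d[OF p0]] DERIV_chain2[OF der d[OF q0]] pq)
  then show "\<exists>D. ((chord_diff k \<delta> u) has_real_derivative D) (at r) \<and> D \<le> 0"
    using le by blast
qed

section \<open>Slice integrals as functions of the slice radius\<close>

context
  fixes k :: "real \<Rightarrow> real" and \<delta> u :: real
  assumes cont: "continuous_on {0<..} k" and anti: "strict_antimono_on {0<..} k"
    and u: "0 < u" "0 < \<delta>" "u \<noteq> \<delta>"
begin

lemma integrable_slice_diff:
  "integrable lborel (\<lambda>y::'b::euclidean_space. indicator (cball 0 \<rho>) y * chord_diff k \<delta> u (norm y))"
proof -
  have pos: "0 < (u - \<delta>)\<^sup>2 + r\<^sup>2" "0 < (u + \<delta>)\<^sup>2 + r\<^sup>2" for r :: real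
    using u by (auto intro!: add_pos_nonneg)
  have "continuous_on (cball (0::'b) \<rho>) (\<lambda>y. chord_diff k \<delta> u (norm y))"
    unfolding chord_diff_def
    by (intro continuous_intros continuous_on_compose2[OF cont]) (use pos in auto)
  from borel_integrable_compact[OF compact_cball this] show ?thesis by simp
qed

lemma integrable_slice_const:
  "integrable lborel (\<lambda>y::'b::euclidean_space. indicator (cball 0 \<rho>) y * (c::real))"
  using emeasure_bounded_finite[of "cball 0 \<rho> :: 'b set"] by (intro integrable_mult_left) auto

text \<open>Subtracting c times the volume of the annulus turns pointwise bounds on
  \<open>chord_diff\<close> by c into bounds on \<open>slice_diff\<close> linear in that
  volume.\<close>

lemma slice_diff_increment:
  fixes V :: real
  defines "V \<equiv> unit_ball_vol (DIM('b::euclidean_space))"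
  assumes "0 \<le> \<rho>1" "\<rho>1 \<le> \<rho>2"
  shows "slice_diff TYPE('b) k \<delta> u \<rho>2 - slice_diff TYPE('b) k \<delta> u \<rho>1 - c * V * (\<rho>2 ^ DIM('b) - \<rho>1 ^ DIM('b))
    = (\<integral>y. indicator (cball (0::'b) \<rho>2 - cball 0 \<rho>1) y * (chord_diff k \<delta> u (norm y) - c) \<partial>lborel)"
    and "integrable lborel (\<lambda>y. indicator (cball (0::'b) \<rho>2 - cball 0 \<rho>1) y * (chord_diff k \<delta> u (norm y) - c))"
proof -
  have eq: "(\<lambda>y. indicator (cball (0::'b) \<rho>2 - cball 0 \<rho>1) y * (chord_diff k \<delta> u (norm y) - c))
    = (\<lambda>y. (indicator (cball (0::'b) \<rho>2) y * chord_diff k \<delta> u (norm y) - indicator (cball 0 \<rho>1) y * chord_diff k \<delta> u (norm y))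
       - (indicator (cball (0::'b) \<rho>2) y * c - indicator (cball 0 \<rho>1) y * c))"
    using assms(3) by (auto simp: fun_eq_iff indicator_def algebra_simps)
  note i = integrable_slice_diff[where 'b='b] integrable_slice_const[where 'b='b]
  show "integrable lborel (\<lambda>y. indicator (cball (0::'b) \<rho>2 - cball 0 \<rho>1) y * (chord_diff k \<delta> u (norm y) - c))"
    unfolding eq by (intro Bochner_Integration.integrable_diff i)
  have vol: "(\<integral>y. indicator (cball (0::'b) \<rho>) y * c \<partial>lborel) = c * V * \<rho> ^ DIM('b)" if "0 \<le> \<rho>" for \<rho>
    using content_cball[OF that, of "0 :: 'b"] by (simp add: V_def)
  show "slice_diff TYPE('b) k \<delta> u \<rho>2 - slice_diff TYPE('b) k \<delta> u \<rho>1 - c * V * (\<rho>2 ^ DIM('b) - \<rho>1 ^ DIM('b))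
    = (\<integral>y. indicator (cball (0::'b) \<rho>2 - cball 0 \<rho>1) y * (chord_diff k \<delta> u (norm y) - c) \<partial>lborel)"
    unfolding eq
    by (subst Bochner_Integration.integral_diff,
        intro Bochner_Integration.integrable_diff i, intro Bochner_Integration.integrable_diff i,
        subst Bochner_Integration.integral_diff, intro i, intro i,
        subst Bochner_Integration.integral_diff, intro i, intro i)
       (simp only: slice_diff_def vol[OF assms(2)] vol[OF order_trans[OF assms(2,3)]],
        simp add: algebra_simps)
qed

lemma slice_diff_increment_le:
  assumes "0 \<le> \<rho>1" "\<rho>1 \<le> \<rho>2"
    and "\<And>r. \<rho>1 \<le> r \<Longrightarrow> r \<le> \<rho>2 \<Longrightarrow> chord_diff k \<delta> u r \<le> c"
  shows "slice_diff TYPE('b::euclidean_space) k \<delta> u \<rho>2 - slice_diff TYPE('b) k \<delta> u \<rho>1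
    \<le> c * unit_ball_vol (DIM('b)) * (\<rho>2 ^ DIM('b) - \<rho>1 ^ DIM('b))"
proof -
  have "0 \<le> (\<integral>y. - (indicator (cball (0::'b) \<rho>2 - cball 0 \<rho>1) y * (chord_diff k \<delta> u (norm y) - c)) \<partial>lborel)"
    using assms(3) by (intro Bochner_Integration.integral_nonneg) (auto simp: indicator_def)
  then have "(\<integral>y. indicator (cball (0::'b) \<rho>2 - cball 0 \<rho>1) y * (chord_diff k \<delta> u (norm y) - c) \<partial>lborel) \<le> 0"
    unfolding integral_minus by simp
  then show ?thesis using slice_diff_increment(1)[where 'b='b, OF assms(1,2), of c] by linarith
qed

lemma slice_diff_increment_ge:
  assumes "0 \<le> \<rho>1" "\<rho>1 \<le> \<rho>2"
    and "\<And>r. \<rho>1 \<le> r \<Longrightarrow> r \<le> \<rho>2 \<Longrightarrow> c \<le> chord_diff k \<delta> u r"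
  shows "c * unit_ball_vol (DIM('b)) * (\<rho>2 ^ DIM('b) - \<rho>1 ^ DIM('b))
    \<le> slice_diff TYPE('b::euclidean_space) k \<delta> u \<rho>2 - slice_diff TYPE('b) k \<delta> u \<rho>1"
proof -
  have "0 \<le> (\<integral>y. indicator (cball (0::'b) \<rho>2 - cball 0 \<rho>1) y * (chord_diff k \<delta> u (norm y) - c) \<partial>lborel)"
    using assms(3) by (intro Bochner_Integration.integral_nonneg) (auto simp: indicator_def)
  then show ?thesis using slice_diff_increment(1)[where 'b='b, OF assms(1,2), of c] by linarith
qed

lemma slice_diff_mono:
  assumes "0 \<le> \<rho>1" "\<rho>1 \<le> \<rho>2"
  shows "slice_diff TYPE('b::euclidean_space) k \<delta> u \<rho>1 \<le> slice_diff TYPE('b) k \<delta> u \<rho>2"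
  using slice_diff_increment_ge[where 'b='b, OF assms, of 0] chord_diff_pos[OF anti u]
  by (simp add: less_imp_le)

lemma slice_diff_strict_mono:
  assumes "0 \<le> \<rho>1" "\<rho>1 < \<rho>2"
  shows "slice_diff TYPE('b::euclidean_space) k \<delta> u \<rho>1 < slice_diff TYPE('b) k \<delta> u \<rho>2"
proof -
  have "0 < (\<integral>y. indicator (cball (0::'b) \<rho>2 - cball 0 \<rho>1) y * (chord_diff k \<delta> u (norm y) - 0) \<partial>lborel)"
  proof (rule integral_pos_of_open[where U="ball 0 \<rho>2 - cball 0 \<rho>1"])
    show "integrable lborel (\<lambda>y. indicator (cball (0::'b) \<rho>2 - cball 0 \<rho>1) y * (chord_diff k \<delta> u (norm y) - 0))"
      using assms by (intro slice_diff_increment(2)) auto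
    show "AE y in lborel. 0 \<le> indicator (cball (0::'b) \<rho>2 - cball 0 \<rho>1) y * (chord_diff k \<delta> u (norm y) - 0)"
      using chord_diff_pos[OF anti u] by (auto simp: less_imp_le)
    obtain e :: 'b where "e \<in> Basis" by (meson nonempty_Basis ex_in_conv)
    then have "((\<rho>1 + \<rho>2) / 2) *\<^sub>R e \<in> ball 0 \<rho>2 - cball 0 \<rho>1"
      using assms by (auto simp: abs_if)
    then show "ball (0::'b) \<rho>2 - cball 0 \<rho>1 \<noteq> {}" by blast
    show "open (ball (0::'b) \<rho>2 - cball 0 \<rho>1)" by (intro open_Diff) auto
    fix y :: 'b assume "y \<in> ball 0 \<rho>2 - cball 0 \<rho>1"
    then show "0 < indicator (cball (0::'b) \<rho>2 - cball 0 \<rho>1) y * (chord_diff k \<delta> u (norm y) - 0)"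
      using chord_diff_pos[OF anti u] by auto
  qed
  then show ?thesis
    using slice_diff_increment(1)[where 'b='b, of \<rho>1 \<rho>2 0] assms by simp
qed

text \<open>As a function of \<open>\<rho>\<^sup>n\<close>, \<open>n = DIM('b)\<close>, i.e. of the volume of the slice, \<open>slice_diff\<close> is
  concave because its density \<open>chord_diff\<close> decreases.\<close>

lemma slice_diff_concave:
  fixes n :: nat
  defines "n \<equiv> DIM('b::euclidean_space)"
  assumes der: "\<And>r. 0 < r \<Longrightarrow> (k has_real_derivative k' r) (at r)"
    and mono: "\<And>x y. 0 < x \<Longrightarrow> lo \<le> x \<Longrightarrow> x \<le> y \<Longrightarrow> y \<le> hi \<Longrightarrow> k' x / x \<le> k' y / y"
    and le: "0 \<le> a" "a \<le> a'" "a \<le> b" "b \<le> b'" "b' ^ n - b ^ n \<le> a' ^ n - a ^ n"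
    and lo: "lo \<le> sqrt ((u - \<delta>)\<^sup>2 + a\<^sup>2)" and hi: "sqrt ((u + \<delta>)\<^sup>2 + b'\<^sup>2) \<le> hi"
  shows "slice_diff TYPE('b) k \<delta> u b' - slice_diff TYPE('b) k \<delta> u b
    \<le> slice_diff TYPE('b) k \<delta> u a' - slice_diff TYPE('b) k \<delta> u a"
proof (cases "b' \<le> a'")
  case True
  then show ?thesis
    using slice_diff_mono[where 'b='b, of b' a'] slice_diff_mono[where 'b='b, of a b] le by auto
next
  case False
  let ?J = "slice_diff TYPE('b) k \<delta> u"
  define V where "V = unit_ball_vol (DIM('b))"
  have V: "0 \<le> V" by (simp add: V_def)
  \<comment> \<open>Removing the possible overlap of [a, a'] and [b, b'] leaves an inner annulus
    from a to p and an outer one from q to b'. The density is at least its value c at p on the inner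
    one and at most c on the outer one.\<close>
  define p q where "p = min a' b" and "q = max a' b"
  define c where "c = chord_diff k \<delta> u p"
  have c0: "0 \<le> c" unfolding c_def using chord_diff_pos[OF anti u] by (rule less_imp_le)
  have pq: "a \<le> p" "p \<le> q" "q \<le> b'" "0 \<le> p" "0 \<le> q" using le False by (auto simp: p_def q_def)
  have dec: "chord_diff k \<delta> u y \<le> chord_diff k \<delta> u x" if "a \<le> x" "x \<le> y" "y \<le> b'" for x y
  proof (rule chord_diff_antimono[OF der mono u])
    show "lo \<le> sqrt ((u - \<delta>)\<^sup>2 + x\<^sup>2)"
      using lo le that by (elim order_trans) (auto intro!: power_mono)
    show "sqrt ((u + \<delta>)\<^sup>2 + y\<^sup>2) \<le> hi"
      using hi le that by (elim order_trans[rotated]) (auto intro!: power_mono)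
  qed (use le that in auto)
  have "?J b' - ?J q \<le> c * V * (b' ^ n - q ^ n)"
    unfolding c_def V_def n_def using pq by (intro slice_diff_increment_le dec) auto
  also have "\<dots> \<le> c * V * (p ^ n - a ^ n)"
    using le c0 V by (intro mult_left_mono) (auto simp: p_def q_def min_def max_def)
  also have "\<dots> \<le> ?J p - ?J a"
    unfolding c_def V_def n_def using pq le by (intro slice_diff_increment_ge dec) auto
  finally have "?J b' + ?J a \<le> ?J p + ?J q" by simp
  also have "?J p + ?J q = ?J a' + ?J b" by (auto simp: p_def q_def min_def max_def)
  finally show ?thesis by simp
qed

end

subsection \<open>Strict concavity along the axis\<close>

text \<open>One-sided limits extend the monotonicity to the endpoints, since distances to the
  frontier may equal \<open>dist_min\<close> or \<open>dist_max\<close>.\<close>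

lemma mono_on_closed_interval:
  fixes f :: "real \<Rightarrow> real"
  assumes mono: "mono_on {d<..<D} f" and cont: "continuous_on {0<..} f"
    and x: "0 < x" "d \<le> x" "x \<le> y" "y \<le> D"
  shows "f x \<le> f y"
proof (cases "x = y")
  case False
  then have xy: "x < y" using x by simp
  have inner: "f p \<le> f q" if "x < p" "p \<le> q" "q < y" for p q
    using monotone_onD[OF mono, of p q] that x by simp
  have tendsto: "(f \<longlongrightarrow> f z) (at z within A)" if "z \<in> {x..y}" for z A
    using continuous_on_interior[OF cont, of z] that x
    by (auto simp: isCont_def interior_open intro: tendsto_within_subset)
  have left: "f x \<le> f q" if q: "x < q" "q < y" for q
  proof (rule tendsto_upperbound)
    show "(f \<longlongrightarrow> f x) (at_right x)"
      using tendsto[of x] xy by simp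
    show "eventually (\<lambda>p. f p \<le> f q) (at_right x)"
      using inner q by (intro eventually_at_rightI[of x q]) auto
  qed simp
  show ?thesis
  proof (rule tendsto_lowerbound)
    show "(f \<longlongrightarrow> f y) (at_left y)"
      using tendsto[of y] xy by simp
    show "eventually (\<lambda>q. f x \<le> f q) (at_left y)"
      using left xy by (intro eventually_at_leftI[of x y]) auto
  qed simp
qed simp

text \<open>Radius 0 outside the unit interval encodes an empty slice, consistently because
  \<open>slice_diff\<close> vanishes at radius 0.\<close>

definition slice_radius :: "(real \<Rightarrow> real) \<Rightarrow> real \<Rightarrow> real" where
  "slice_radius \<omega> t = (if t \<in> {0..1} then \<omega> t else 0)"

context
  fixes \<omega> :: "real \<Rightarrow> real" and \<Omega> :: "(real \<times> 'b::euclidean_space) set"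
    and k k' :: "real \<Rightarrow> real" and \<delta> s s' :: real
  assumes nonneg: "\<And>t. t \<in> {0..1} \<Longrightarrow> 0 \<le> \<omega> t"
    and conc: "concave_on {0..1} (\<lambda>t. \<omega> t ^ DIM('b))"
    and \<Omega>: "\<Omega> = solid_of_revolution \<omega>" and bd: "body \<Omega>"
    and cont: "continuous_on {0<..} k" and anti: "strict_antimono_on {0<..} k"
    and der: "\<And>r. 0 < r \<Longrightarrow> (k has_real_derivative k' r) (at r)"
    and mono: "\<And>x y. 0 < x \<Longrightarrow> dist_min \<Omega> \<le> x \<Longrightarrow> x \<le> y \<Longrightarrow> y \<le> dist_max \<Omega> \<Longrightarrow> k' x / x \<le> k' y / y"
    and loc: "\<And>R. integrable lborel (\<lambda>z::real \<times> 'b. indicator (cball 0 R) z * k (norm z))"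
    and \<delta>: "0 < \<delta>" and ss': "s < s'"
    and Uf: "(s - \<delta>, 0) \<in> min_unfolded_region \<Omega>" "(s' + \<delta>, 0) \<in> min_unfolded_region \<Omega>"
begin

definition "axial_pull = slice_diff TYPE('b) k \<delta>"

lemma Uf_between: "s - \<delta> \<le> x \<Longrightarrow> x \<le> s' + \<delta> \<Longrightarrow> (x, 0) \<in> min_unfolded_region \<Omega>"
  using Uf by (rule min_unfolded_region_segment)

lemma segment_in_unit_interval: "0 < s" "s' < 1"
  using min_unfolded_region_range[OF nonneg conc \<Omega> bd Uf(1)]
    min_unfolded_region_range[OF nonneg conc \<Omega> bd Uf(2)] \<delta> by auto

lemma slice_radius_nonneg: "0 \<le> slice_radius \<omega> t"
  using nonneg by (simp add: slice_radius_def)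

lemma slice_radius_pos: "0 < t \<Longrightarrow> t < 1 \<Longrightarrow> 0 < slice_radius \<omega> t"
  using radius_pos[OF nonneg conc \<Omega> bd] by (simp add: slice_radius_def)

text \<open>For u > s the mirror height s - u has left the solid, so s + u > 2 s lies where
  \<open>radius_antimono_reflected_left\<close> makes \<omega> decrease. The next lemma treats the
  other end.\<close>

lemma slice_radius_antimono:
  assumes "s < u" "0 < u"
  shows "slice_radius \<omega> (s' + u) \<le> slice_radius \<omega> (s + u)"
proof (cases "s' + u \<le> 1")
  case True
  then have "\<omega> (s' + u) \<le> \<omega> (s + u)"
    using assms ss' \<delta>
    by (intro radius_antimono_reflected_left[OF nonneg conc \<Omega> bd Uf_between[of s]]) auto
  then show ?thesis using True assms segment_in_unit_interval ss' by (simp add: slice_radius_def)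
qed (use slice_radius_nonneg[of "s + u"] in \<open>simp add: slice_radius_def\<close>)

lemma slice_radius_mono:
  assumes "1 < s' + u" "0 < u"
  shows "slice_radius \<omega> (s - u) \<le> slice_radius \<omega> (s' - u)"
proof (cases "0 \<le> s - u")
  case True
  then have "\<omega> (s - u) \<le> \<omega> (s' - u)"
    using assms ss' \<delta>
    by (intro radius_mono_reflected_right[OF nonneg conc \<Omega> bd Uf_between[of s']]) auto
  then show ?thesis using True assms segment_in_unit_interval ss' by (simp add: slice_radius_def)
qed (use slice_radius_nonneg[of "s' - u"] in \<open>simp add: slice_radius_def\<close>)

lemma axial_pull_mono: "0 < u \<Longrightarrow> u \<noteq> \<delta> \<Longrightarrow> 0 \<le> a \<Longrightarrow> a \<le> b \<Longrightarrow> axial_pull u a \<le> axial_pull u b"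
  unfolding axial_pull_def using \<delta> by (intro slice_diff_mono[OF cont anti])

lemma axial_pull_strict_mono: "0 < u \<Longrightarrow> u \<noteq> \<delta> \<Longrightarrow> 0 \<le> a \<Longrightarrow> a < b \<Longrightarrow> axial_pull u a < axial_pull u b"
  unfolding axial_pull_def using \<delta> by (intro slice_diff_strict_mono[OF cont anti])

lemma axial_pull_0: "axial_pull u 0 = 0"
  by (simp add: axial_pull_def slice_diff_0)

lemma distance_bounds:
  assumes "t \<in> {0..1}" "s - \<delta> \<le> c" "c \<le> s' + \<delta>" "\<bar>v\<bar> = \<bar>c - t\<bar>"
  shows "dist_min \<Omega> \<le> sqrt (v\<^sup>2 + (\<omega> t)\<^sup>2)" "sqrt (v\<^sup>2 + (\<omega> t)\<^sup>2) \<le> dist_max \<Omega>"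
proof -
  have "v\<^sup>2 = (c - t)\<^sup>2" using assms(4) by (metis power2_abs)
  then show "dist_min \<Omega> \<le> sqrt (v\<^sup>2 + (\<omega> t)\<^sup>2)" "sqrt (v\<^sup>2 + (\<omega> t)\<^sup>2) \<le> dist_max \<Omega>"
    using dist_generating_curve[OF nonneg conc \<Omega> bd Uf_between[OF assms(2,3)] assms(1)] by simp_all
qed

text \<open>The axis points \<open>ca\<close> and \<open>cb\<close> realize the smallest near
  distance and the largest far distance as distances to the generating curve, so both lie between
  \<open>dist_min\<close> and \<open>dist_max\<close>.\<close>

lemma axial_pull_concave:
  assumes u: "0 < u" "u \<noteq> \<delta>" and t: "ta \<in> {0..1}" "tb \<in> {0..1}"
    and le: "\<omega> ta \<le> a'" "\<omega> ta \<le> b" "b \<le> \<omega> tb"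
      "\<omega> tb ^ DIM('b) - b ^ DIM('b) \<le> a' ^ DIM('b) - \<omega> ta ^ DIM('b)"
    and ca: "s - \<delta> \<le> ca" "ca \<le> s' + \<delta>" "\<bar>u - \<delta>\<bar> = \<bar>ca - ta\<bar>"
    and cb: "s - \<delta> \<le> cb" "cb \<le> s' + \<delta>" "\<bar>u + \<delta>\<bar> = \<bar>cb - tb\<bar>"
  shows "axial_pull u (\<omega> tb) - axial_pull u b \<le> axial_pull u a' - axial_pull u (\<omega> ta)"
  unfolding axial_pull_def
  by (rule slice_diff_concave[OF cont anti u(1) \<delta> u(2) der mono nonneg[OF t(1)] le
        distance_bounds(1)[OF t(1) ca] distance_bounds(2)[OF t(2) cb]])

lemma axial_pull_balance:
  assumes u: "0 < u" "u \<noteq> \<delta>"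
  shows "axial_pull u (slice_radius \<omega> (s' + u)) - axial_pull u (slice_radius \<omega> (s + u)) \<le> axial_pull u (slice_radius \<omega> (s' - u)) - axial_pull u (slice_radius \<omega> (s - u))"
proof -
  consider "s < u" | "u \<le> s" "1 < s' + u" | "u \<le> s" "s' + u \<le> 1" by linarith
  then show ?thesis
  proof cases
    case 1
    have "slice_radius \<omega> (s - u) = 0" using 1 by (simp add: slice_radius_def)
    moreover have "axial_pull u (slice_radius \<omega> (s' + u)) \<le> axial_pull u (slice_radius \<omega> (s + u))"
      using slice_radius_antimono[OF 1 u(1)] by (intro axial_pull_mono u slice_radius_nonneg)
    moreover have "axial_pull u 0 \<le> axial_pull u (slice_radius \<omega> (s' - u))" by (intro axial_pull_mono u slice_radius_nonneg) simp
    ultimately show ?thesis by (simp add: axial_pull_0)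
  next
    case 2
    have "slice_radius \<omega> (s' + u) = 0" using 2 by (simp add: slice_radius_def)
    moreover have "axial_pull u (slice_radius \<omega> (s - u)) \<le> axial_pull u (slice_radius \<omega> (s' - u))"
      using slice_radius_mono[OF 2(2) u(1)] by (intro axial_pull_mono u slice_radius_nonneg)
    moreover have "axial_pull u 0 \<le> axial_pull u (slice_radius \<omega> (s + u))" by (intro axial_pull_mono u slice_radius_nonneg) simp
    ultimately show ?thesis by (simp add: axial_pull_0)
  next
    case 3
    define A A' B B' where "A = \<omega> (s - u)" and "A' = \<omega> (s' - u)"
      and "B = \<omega> (s + u)" and "B' = \<omega> (s' + u)"
    have I: "s - u \<in> {0..1}" "s' - u \<in> {0..1}" "s + u \<in> {0..1}" "s' + u \<in> {0..1}"
      using 3 segment_in_unit_interval ss' u by auto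
    have w: "slice_radius \<omega> (s - u) = A" "slice_radius \<omega> (s' - u) = A'" "slice_radius \<omega> (s + u) = B" "slice_radius \<omega> (s' + u) = B'"
      using I by (simp_all add: slice_radius_def A_def A'_def B_def B'_def)
    have nn: "0 \<le> A" "0 \<le> A'" "0 \<le> B" "0 \<le> B'"
      using I nonneg by (auto simp: A_def A'_def B_def B'_def)
    \<comment> \<open>Concavity compares the increments of \<omega>^n over the translates of an
      interval of length s' - s starting at s - u and at s + u.\<close>
    have diff: "B' ^ DIM('b) - B ^ DIM('b) \<le> A' ^ DIM('b) - A ^ DIM('b)"
      using concave_on_diff_mono[OF conc, of "s - u" "s + u" "s' - s"] I ss' u
      by (simp add: A_def A'_def B_def B'_def add.commute[of u])
    note min = radius_min_le[OF nonneg conc \<Omega> bd]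
    show ?thesis
    \<comment> \<open>If the right slice grows, so does the left one, and concavity of the pull
      applies. If both shrink, it applies with left and right exchanged. Otherwise the signs of the
      two differences decide.\<close>
    proof (cases "B < B'")
      case True
      have AB: "A \<le> B"
        using min[of "s - u" "s + u" "s' + u"] I True u ss' by (auto simp: A_def B_def B'_def)
      have "0 \<le> B' ^ DIM('b) - B ^ DIM('b)" using True nn by (simp add: power_mono)
      then have "A ^ DIM('b) \<le> A' ^ DIM('b)" using diff by linarith
      then have AA: "A \<le> A'" using nn by (simp add: power_mono_iff)
      have "axial_pull u (\<omega> (s' + u)) - axial_pull u B \<le> axial_pull u A' - axial_pull u (\<omega> (s - u))"
      \<comment> \<open>Seen from s - \<delta> the slice at s - u is at axial distance |u -
        \<delta>|; seen from s' - \<delta> the slice at s' + u is at u + \<delta>.\<close>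
      proof (rule axial_pull_concave[OF u I(1,4), where ca="s - \<delta>" and cb="s' - \<delta>"])
        show "\<omega> (s' + u) ^ DIM('b) - B ^ DIM('b) \<le> A' ^ DIM('b) - \<omega> (s - u) ^ DIM('b)"
          using diff by (simp add: A_def B'_def)
      qed (use AA AB True ss' \<delta> in \<open>simp_all add: A_def B'_def\<close>)
      then show ?thesis unfolding w by (simp add: A_def B'_def)
    next
      case BB: False
      show ?thesis
      proof (cases "A \<le> A'")
        case True
        then show ?thesis
          using axial_pull_mono[OF u nn(1) True] axial_pull_mono[OF u nn(4), of B] BB unfolding w by linarith
      next
        case False
        have AB: "B' \<le> A'"
          using min[of "s - u" "s' - u" "s' + u"] I False u ss' by (auto simp: A_def A'_def B'_def)
        have "axial_pull u (\<omega> (s - u)) - axial_pull u A' \<le> axial_pull u B - axial_pull u (\<omega> (s' + u))"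
        \<comment> \<open>Mirrored: s' + \<delta> is at axial distance |u - \<delta>| from s' + u,
          and s + \<delta> is at u + \<delta> from s - u.\<close>
        proof (rule axial_pull_concave[OF u I(4,1), where ca="s' + \<delta>" and cb="s + \<delta>"])
          show "\<omega> (s - u) ^ DIM('b) - A' ^ DIM('b) \<le> B ^ DIM('b) - \<omega> (s' + u) ^ DIM('b)"
            using diff by (simp add: A_def B'_def)
        qed (use AB BB False ss' \<delta> in \<open>simp_all add: A_def B'_def\<close>)
        then show ?thesis unfolding w by (simp add: A_def B'_def)
      qed
    qed
  qed
qed

text \<open>Strictness arises because s - u has already left the unit interval while s' - u is still
  interior and so has a slice of positive radius.\<close>

lemma axial_pull_balance_strict_left:
  assumes u: "s < u" "u < s'" "u \<noteq> \<delta>"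
  shows "axial_pull u (slice_radius \<omega> (s' + u)) - axial_pull u (slice_radius \<omega> (s + u)) < axial_pull u (slice_radius \<omega> (s' - u)) - axial_pull u (slice_radius \<omega> (s - u))"
proof -
  have u0: "0 < u" using u segment_in_unit_interval by simp
  have "slice_radius \<omega> (s - u) = 0" using u by (simp add: slice_radius_def)
  moreover have "axial_pull u (slice_radius \<omega> (s' + u)) \<le> axial_pull u (slice_radius \<omega> (s + u))"
    using slice_radius_antimono[OF u(1) u0] by (intro axial_pull_mono u0 u slice_radius_nonneg)
  moreover have "axial_pull u 0 < axial_pull u (slice_radius \<omega> (s' - u))"
    using u segment_in_unit_interval by (intro axial_pull_strict_mono u0 u slice_radius_pos) auto
  ultimately show ?thesis by (simp add: axial_pull_0)
qed

lemma potential_diff_slices: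
  shows "integrable lborel (\<lambda>u. axial_pull u (slice_radius \<omega> (c + u)))"
    and "potential k \<Omega> (c + \<delta>, 0) - potential k \<Omega> (c - \<delta>, 0) = (\<integral>u. axial_pull u (slice_radius \<omega> (c + u)) \<partial>lborel)"
proof -
  define f where "f y = indicator \<Omega> y * k (norm ((c + \<delta>, 0) - y)) - indicator \<Omega> y * k (norm ((c - \<delta>, 0) - y))"
    for y :: "real \<times> 'b"
  note i = integrable_potential[OF cont loc body_imp_compact[OF bd]]
  have int: "integrable lborel f"
    unfolding f_def by (intro Bochner_Integration.integrable_diff i)
  have val: "integral\<^sup>L lborel f = potential k \<Omega> (c + \<delta>, 0) - potential k \<Omega> (c - \<delta>, 0)"
    unfolding f_def potential_altdef by (intro Bochner_Integration.integral_diff i)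
  \<comment> \<open>Centering at the midpoint of the two sources makes the inner integral of
    Fubini's theorem a \<open>slice_diff\<close> at height u.\<close>
  define g where "g z = f ((c, 0) + z)" for z
  have int_g: "integrable lborel g"
    unfolding g_def using integrable_distr[of "(+) (c, 0)" lborel borel f] int
    by (simp add: lborel_distr_plus)
  have val_g: "integral\<^sup>L lborel g = integral\<^sup>L lborel f"
    unfolding g_def using int
    by (subst (2) lborel_distr_plus[of "(c, 0)", symmetric], subst integral_distr) auto
  have slice: "(\<integral>y. g (u, y) \<partial>lborel) = axial_pull u (slice_radius \<omega> (c + u))" for u
  proof (cases "c + u \<in> {0..1}")
    case True
    have "g (u, y) = indicator (cball 0 (slice_radius \<omega> (c + u))) y * chord_diff k \<delta> u (norm y)" for y
      using True
      by (simp add: g_def f_def \<Omega> mem_solid_of_revolution slice_radius_def norm_Pair chord_diff_def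
          indicator_def power2_commute[of \<delta>] power2_commute[of "- \<delta>"] add.commute)
    then show ?thesis by (simp add: axial_pull_def slice_diff_def)
  next
    case False
    then have "g (u, y) = 0" for y
      by (auto simp: g_def f_def \<Omega> mem_solid_of_revolution)
    moreover have "slice_radius \<omega> (c + u) = 0" using False by (auto simp: slice_radius_def)
    ultimately show ?thesis by (simp add: axial_pull_0)
  qed
  have "integrable (lborel \<Otimes>\<^sub>M lborel) g" using int_g by (simp add: lborel_prod)
  from lborel_pair.integrable_fst'[OF this] lborel_pair.integral_fst'[OF this]
  show "integrable lborel (\<lambda>u. axial_pull u (slice_radius \<omega> (c + u)))"
    "potential k \<Omega> (c + \<delta>, 0) - potential k \<Omega> (c - \<delta>, 0) = (\<integral>u. axial_pull u (slice_radius \<omega> (c + u)) \<partial>lborel)"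
    by (simp_all add: slice lborel_prod val val_g)
qed

theorem potential_increment_less:
  "potential k \<Omega> (s' + \<delta>, 0) - potential k \<Omega> (s' - \<delta>, 0)
    < potential k \<Omega> (s + \<delta>, 0) - potential k \<Omega> (s - \<delta>, 0)"
proof -
  define j where "j u = axial_pull u (slice_radius \<omega> (s + u)) - axial_pull u (slice_radius \<omega> (s' + u))" for u
  have int: "integrable lborel j"
    unfolding j_def by (intro Bochner_Integration.integrable_diff potential_diff_slices)
  have val: "integral\<^sup>L lborel j = (potential k \<Omega> (s + \<delta>, 0) - potential k \<Omega> (s - \<delta>, 0))
      - (potential k \<Omega> (s' + \<delta>, 0) - potential k \<Omega> (s' - \<delta>, 0))"
    unfolding j_def potential_diff_slices(2)
    by (intro Bochner_Integration.integral_diff potential_diff_slices)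
  have int': "integrable lborel (\<lambda>u. j (- u))"
    using lborel_integrable_real_affine[OF int, of "-1" 0] by simp
  have val': "(\<integral>u. j (- u) \<partial>lborel) = integral\<^sup>L lborel j"
    using lborel_integral_real_affine[of "-1" j 0] by simp
  \<comment> \<open>Symmetrizing doubles the integral and, as the pull is odd in u, turns the
    integrand into the difference estimated by \<open>axial_pull_balance\<close>.\<close>
  define G where "G u = j u + j (- u)" for u
  have G: "G u = (axial_pull u (slice_radius \<omega> (s' - u)) - axial_pull u (slice_radius \<omega> (s - u))) - (axial_pull u (slice_radius \<omega> (s' + u)) - axial_pull u (slice_radius \<omega> (s + u)))" for u
    by (simp add: G_def j_def axial_pull_def slice_diff_minus)
  have "0 < integral\<^sup>L lborel G"
  proof (rule integral_pos_of_open)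
    show "integrable lborel G"
      unfolding G_def using int int' by (rule Bochner_Integration.integrable_add)
    have pos: "0 \<le> G u" if "0 < u" "u \<noteq> \<delta>" for u
      using axial_pull_balance[OF that] by (simp add: G)
    have G0: "0 \<le> G u" if "u \<noteq> 0" "u \<noteq> \<delta>" "u \<noteq> - \<delta>" for u
      using pos[of u] pos[of "- u"] that by (cases "0 < u") (auto simp: G_def add.commute)
    show "AE u in lborel. 0 \<le> G u"
      using AE_lborel_singleton[of 0] AE_lborel_singleton[of \<delta>] AE_lborel_singleton[of "- \<delta>"]
      by eventually_elim (rule G0)
    show "open ({s<..<s'} - {\<delta>})" by (intro open_delete) auto
    have "infinite {s<..<s'}" using ss' by simp
    then show "{s<..<s'} - {\<delta>} \<noteq> {}" by (metis finite.emptyI finite_Diff_insert Diff_empty)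
    fix u assume "u \<in> {s<..<s'} - {\<delta>}"
    then show "0 < G u" using axial_pull_balance_strict_left[of u] by (simp add: G)
  qed
  moreover have "integral\<^sup>L lborel G = 2 * integral\<^sup>L lborel j"
    unfolding G_def by (subst Bochner_Integration.integral_add[OF int int']) (simp add: val')
  ultimately show ?thesis by (simp add: val)
qed

end

section \<open>Combining existence and uniqueness\<close>

theorem unique_k_center_solid_of_revolution:
  fixes \<omega> k :: "real \<Rightarrow> real" and \<Omega> :: "(real \<times> 'b::euclidean_space) set" and \<alpha> :: real
  assumes nonneg: "\<And>t. t \<in> {0..1} \<Longrightarrow> 0 \<le> \<omega> t"
    and conc: "concave_on {0..1} (\<lambda>t. \<omega> t ^ DIM('b))"
    and \<Omega>: "\<Omega> = solid_of_revolution \<omega>" and bd: "body \<Omega>"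
    and anti: "strict_antimono_on {0<..} k"
    and \<alpha>: "1 < \<alpha>" and C1: "C1_cond (DIM(real \<times> 'b)) \<alpha> k"
    and mono: "mono_on {dist_min \<Omega><..<dist_max \<Omega>} (\<lambda>r. deriv k r / r)"
  shows "\<exists>!x. k_center k \<Omega> x"
proof -
  note cont = C1_cond_imp_continuous_on[OF C1]
  have "2 \<le> DIM(real \<times> 'b)" using DIM_positive[where 'a='b] by simp
  note loc = locally_integrable_radial[OF C1 this \<alpha>]
  obtain D where D: "\<And>r. 0 < r \<Longrightarrow> (k has_vector_derivative D r) (at r)" "continuous_on {0<..} D"
    using C1 by (auto simp: C1_cond_def C1_differentiable_on_def)
  then have deriv: "deriv k r = D r" if "0 < r" for r
    using that by (metis DERIV_imp_deriv has_real_derivative_iff_has_vector_derivative)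
  have der: "(k has_real_derivative deriv k r) (at r)" if "0 < r" for r
    using D(1)[OF that] deriv[OF that] by (simp add: has_real_derivative_iff_has_vector_derivative)
  have "continuous_on {0<..} (\<lambda>r. D r / r)" by (intro continuous_intros D(2)) auto
  then have "continuous_on {0<..} (\<lambda>r. deriv k r / r)"
    by (rule continuous_on_cong[THEN iffD1, rotated 2]) (auto simp: deriv)
  note mono' = mono_on_closed_interval[OF mono this]
  have unique: "x1 = x2" if c: "k_center k \<Omega> x1" "k_center k \<Omega> x2" for x1 x2
  proof -
    note Uf = k_center_in_min_unfolded_region[OF cont loc anti bd]
    obtain s1 s2 y1 y2 where x: "x1 = (s1, y1)" "x2 = (s2, y2)" by force
    have y: "y1 = 0" "y2 = 0"
      using Uf[OF c(1)] Uf[OF c(2)] min_unfolded_region_on_axis[OF nonneg conc \<Omega> bd]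
      unfolding x by blast+
    have False if ab: "a < b" "k_center k \<Omega> (a, 0)" "k_center k \<Omega> (b, 0)" for a b
    proof -
      \<comment> \<open>A quarter of the distance: the increments centered at a + \<delta> and b -
        \<delta> then run from a to the midpoint and from the midpoint to b. Two maxima would make
        the first nonnegative to the left of the midpoint impossible to exceed 0 and the second at
        least 0, against their strict decrease.\<close>
      define \<delta> where "\<delta> = (b - a) / 4"
      have \<delta>: "0 < \<delta>" "a + \<delta> < b - \<delta>" using ab(1) by (auto simp: \<delta>_def field_simps)
      have mid: "a + \<delta> + \<delta> = b - \<delta> - \<delta>" by (simp add: \<delta>_def field_simps)
      have "potential k \<Omega> (b - \<delta> + \<delta>, 0) - potential k \<Omega> (b - \<delta> - \<delta>, 0)
          < potential k \<Omega> (a + \<delta> + \<delta>, 0) - potential k \<Omega> (a + \<delta> - \<delta>, 0)"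
        using Uf[OF ab(2)] Uf[OF ab(3)]
        by (intro potential_increment_less[OF nonneg conc \<Omega> bd cont anti der mono' loc \<delta>]) auto
      moreover have "potential k \<Omega> (b - \<delta> - \<delta>, 0) \<le> potential k \<Omega> (a, 0)"
          "potential k \<Omega> (b - \<delta> - \<delta>, 0) \<le> potential k \<Omega> (b, 0)"
        using ab(2,3) by (auto simp: k_center_def)
      ultimately show False unfolding mid by simp
    qed
    then have "s1 = s2" using c unfolding x y by (metis linorder_neqE)
    then show ?thesis by (simp add: x y)
  qed
  with k_center_exists[OF cont loc anti bd] show ?thesis by blast
qed

theorem corollary4p2:
  fixes m :: nat
    and \<omega> :: "real \<Rightarrow> real"
    and \<Omega> :: "(real \<times> (real ^ 'n)) set"
    and k :: "real \<Rightarrow> real"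
    and \<alpha> :: real
  assumes "m \<ge> 2" and "CARD('n) = m - 1"
    and "\<And>t. t \<in> {0..1} \<Longrightarrow> \<omega> t \<ge> 0"
    and "\<omega> piecewise_C1_differentiable_on {0..1}"
    and "concave_on {0..1} (\<lambda>t. \<omega> t ^ (m - 1))"
    and "\<Omega> = solid_of_revolution \<omega>"
    and "body \<Omega>"
    and "strict_antimono_on {0<..} k"
    and "\<alpha> > 1" and "C1_cond m \<alpha> k"
    and "mono_on {dist_min \<Omega><..<dist_max \<Omega>} (\<lambda>r. deriv k r / r)"
  shows "\<exists>!x. k_center k \<Omega> x"
proof -
  have dim: "DIM(real ^ 'n) = m - 1" "DIM(real \<times> (real ^ 'n)) = m"
    using assms(1,2) by simp_all
  show ?thesis
    by (rule unique_k_center_solid_of_revolution[where \<omega>=\<omega> and \<alpha>=\<alpha>])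
      (use assms in \<open>simp_all only: dim\<close>)
qed

end
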